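(* Let $n\geq1$ and let $q$ be a nonzero complex number which is not a root of unity. Every finite-dimensional irreducible representation $V$ of $\mathrm{U}'_q(\mathfrak{sp}_{2n})$ is isomorphic to $L(\lambda)$ for a certain highest weight $\lambda$ (an $n$-tuple $\lambda=(\lambda_1,\lambda_3,\dots,\lambda_{2n-1})$ of nonzero complex numbers).
   Context: $\mathrm{U}'_q(\mathfrak{sp}_{2n})$ is the unital associative $\mathbb{C}$-algebra generated by elements $s_{ij}$, $i,j\in\{1,\dots,2n\}$, and $s_{i,i+1}^{-1}$, $i=1,3,\dots,2n-1$, subject to the following relations. (1) $s_{ij}=0$ for $j=i+1$ with $i$ even, and for $j\geq i+2$ and all $i$. (2) $s_{i,i+1}s_{i,i+1}^{-1}=s_{i,i+1}^{-1}s_{i,i+1}=1$ for $i=1,3,\dots,2n-1$. (3) $s_{i+1,i+1}s_{ii}-q^2 s_{i+1,i}s_{i,i+1}=q^3$ for $i=1,3,\dots,2n-1$. (4) For all $i,a,j,b\in\{1,\dots,2n\}$, $$ \begin{aligned} q^{\delta_{aj}+\delta_{ij}} s_{ia}s_{jb}-q^{\delta_{ab}+\delta_{ib}} s_{jb}s_{ia} &=(q-q^{-1})\,q^{\delta_{ai}}(\delta_{b<a}-\delta_{i<j})\,s_{ja}s_{ib}\\ &\quad+(q-q^{-1})\big(q^{\delta_{ab}}\delta_{b<i}\,s_{ji}s_{ba}-q^{\delta_{ij}}\delta_{a<j}\,s_{ij}s_{ab}\big)\\ &\quad+(q-q^{-1})^2(\delta_{b<a<i}-\delta_{a<i<j})\,s_{ji}s_{ab},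 \end{aligned} $$ where $\delta_{ij}$ is the Kronecker delta and $\delta_{i<j}$ (respectively $\delta_{i<j<k}$) equals $1$ if the subscript inequality holds and $0$ otherwise. A representation $V$ of $\mathrm{U}'_q(\mathfrak{sp}_{2n})$ is a highest weight representation with highest weight $\lambda=(\lambda_1,\lambda_3,\dots,\lambda_{2n-1})$ (an $n$-tuple of nonzero complex numbers) if it is generated by a nonzero vector $v$ with $s_{ij}v=0$ for $i=1,3,\dots,2n-1$, $j=1,2,\dots,i$, and $s_{i,i+1}v=\lambda_i v$ for $i=1,3,\dots,2n-1$. The Verma module $M(\lambda)$ is the quotient of $\mathrm{U}'_q(\mathfrak{sp}_{2n})$ by the left ideal generated by the elements $s_{ij}$ ($i=1,3,\dots,2n-1$, $j=1,\dots,i$) and $s_{i,i+1}-\lambda_i$ ($i=1,3,\dots,2n-1$). $M(\lambda)$ has a unique maximal submodule not containing the image $\xi$ of $1$, and $L(\lambda)$ denotes the quotient of $M(\lambda)$ by it; it is, up to isomorphism, the unique irreducible highest weight representation with highest weight $\lambda$. *)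

theory Defs
  imports Complex_Main "HOL-Algebra.Algebra" "HOL-Library.Poly_Mapping"
begin

section \<open>Left modules over a not necessarily commutative ring\<close>

text \<open>
  The locale \<^locale>\<open>module\<close> of HOL-Algebra assumes a commutative ring of scalars.
  Its record type and its locale \<^locale>\<open>submodule\<close> do not, and are reused here.  The fields
  \<^const>\<open>monoid.mult\<close> and \<^const>\<open>monoid.one\<close> of that record play no role in a module.
\<close>

locale left_module = R?: ring R + M?: abelian_group M
    for R :: "('a, 'c) ring_scheme" (structure) and M :: "('a, 'b, 'd) module_scheme" (structure) +
  assumes smult_closed [simp, intro]:
      "\<lbrakk>a \<in> carrier R; x \<in> carrier M\<rbrakk> \<Longrightarrow> a \<odot>\<^bsub>M\<^esub> x \<in> carrier M"
    and smult_l_distr: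
      "\<lbrakk>a \<in> carrier R; b \<in> carrier R; x \<in> carrier M\<rbrakk> \<Longrightarrow>
        (a \<oplus> b) \<odot>\<^bsub>M\<^esub> x = a \<odot>\<^bsub>M\<^esub> x \<oplus>\<^bsub>M\<^esub> b \<odot>\<^bsub>M\<^esub> x"
    and smult_r_distr:
      "\<lbrakk>a \<in> carrier R; x \<in> carrier M; y \<in> carrier M\<rbrakk> \<Longrightarrow>
        a \<odot>\<^bsub>M\<^esub> (x \<oplus>\<^bsub>M\<^esub> y) = a \<odot>\<^bsub>M\<^esub> x \<oplus>\<^bsub>M\<^esub> a \<odot>\<^bsub>M\<^esub> y"
    and smult_assoc:
      "\<lbrakk>a \<in> carrier R; b \<in> carrier R; x \<in> carrier M\<rbrakk> \<Longrightarrow>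
        (a \<otimes> b) \<odot>\<^bsub>M\<^esub> x = a \<odot>\<^bsub>M\<^esub> (b \<odot>\<^bsub>M\<^esub> x)"
    and smult_one [simp]: "x \<in> carrier M \<Longrightarrow> \<one> \<odot>\<^bsub>M\<^esub> x = x"

definition irreducible_module :: "('a, 'c) ring_scheme \<Rightarrow> ('a, 'b) module \<Rightarrow> bool" where
  "irreducible_module R M \<longleftrightarrow>
     carrier M \<noteq> {\<zero>\<^bsub>M\<^esub>} \<and>
     (\<forall>N. submodule N R M \<longrightarrow> N = {\<zero>\<^bsub>M\<^esub>} \<or> N = carrier M)"

definition isomorphic_modules ::
    "('a, 'c) ring_scheme \<Rightarrow> ('a, 'b) module \<Rightarrow> ('a, 'd) module \<Rightarrow> bool" where
  "isomorphic_modules R M M' \<longleftrightarrow>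
     (\<exists>f. bij_betw f (carrier M) (carrier M') \<and>
          (\<forall>x\<in>carrier M. \<forall>y\<in>carrier M. f (x \<oplus>\<^bsub>M\<^esub> y) = f x \<oplus>\<^bsub>M'\<^esub> f y) \<and>
          (\<forall>a\<in>carrier R. \<forall>x\<in>carrier M. f (a \<odot>\<^bsub>M\<^esub> x) = a \<odot>\<^bsub>M'\<^esub> f x))"

definition quotient_module :: "('a, 'b) module \<Rightarrow> 'b set \<Rightarrow> ('a, 'b set) module" where
  "quotient_module M N =
     \<lparr>carrier = a_rcosets\<^bsub>M\<^esub> N, monoid.mult = undefined, monoid.one = undefined,
      ring.zero = N, ring.add = set_add M,
      smult = (\<lambda>a C. \<Union>x\<in>C. N +>\<^bsub>M\<^esub> (a \<odot>\<^bsub>M\<^esub> x))\<rparr>"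

definition regular_module :: "('a, 'c) ring_scheme \<Rightarrow> ('a, 'a) module" where
  "regular_module R =
     \<lparr>carrier = carrier R, monoid.mult = monoid.mult R, monoid.one = monoid.one R,
      ring.zero = ring.zero R, ring.add = ring.add R,
      smult = monoid.mult R\<rparr>"

definition left_ideal_gen :: "('a, 'c) ring_scheme \<Rightarrow> 'a set \<Rightarrow> 'a set" where
  "left_ideal_gen R S = \<Inter>{J. submodule J R (regular_module R) \<and> S \<subseteq> J}"

definition maximal_submodule_avoiding ::
    "('a, 'c) ring_scheme \<Rightarrow> ('a, 'b) module \<Rightarrow> 'b \<Rightarrow> 'b set" where
  "maximal_submodule_avoiding R M x =
     (THE N. submodule N R M \<and> x \<notin> N \<and>
        (\<forall>N'. submodule N' R M \<longrightarrow> x \<notin> N' \<longrightarrow> N \<subseteq> N' \<longrightarrow> N' = N))"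


section \<open>Free associative algebras over the complex numbers\<close>

datatype 'x free_monoid = FM (letters: "'x list")

instantiation free_monoid :: (type) monoid_add
begin
definition "0 = FM []"
definition "u + v = FM (letters u @ letters v)"
instance
  by standard (simp_all add: zero_free_monoid_def plus_free_monoid_def)
end

text \<open>
  The monoid algebra of the free monoid: the product of \<^typ>\<open>'x free_monoid \<Rightarrow>\<^sub>0 complex\<close>
  is convolution with respect to concatenation of words.
\<close>

type_synonym 'x free_alg = "'x free_monoid \<Rightarrow>\<^sub>0 complex"

definition free_alg :: "'x set \<Rightarrow> 'x free_alg ring" where
  "free_alg C =
     \<lparr>carrier = {f. \<forall>w\<in>Poly_Mapping.keys f. set (letters w) \<subseteq> C},
      monoid.mult = (*), monoid.one = 1, ring.zero = 0, ring.add = (+)\<rparr>"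

definition fgen :: "'x \<Rightarrow> 'x free_alg" where
  "fgen x = Poly_Mapping.single (FM [x]) 1"

definition fconst :: "complex \<Rightarrow> 'x free_alg" where
  "fconst c = Poly_Mapping.single 0 c"


section \<open>The twisted quantized enveloping algebra\<close>

text \<open>\<open>S i j\<close> stands for $s_{ij}$ and \<open>Sinv i\<close> for $s_{i,i+1}^{-1}$.\<close>

datatype sp_gen = S nat nat | Sinv nat

definition odds :: "nat \<Rightarrow> nat set" where
  "odds n = {i. odd i \<and> i < 2 * n}"

definition sp_gens :: "nat \<Rightarrow> sp_gen set" where
  "sp_gens n = {S i j | i j. i \<in> {1..2*n} \<and> j \<in> {1..2*n}} \<union> Sinv ` odds n"

abbreviation fs :: "nat \<Rightarrow> nat \<Rightarrow> sp_gen free_alg" where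
  "fs i j \<equiv> fgen (S i j)"

abbreviation fsinv :: "nat \<Rightarrow> sp_gen free_alg" where
  "fsinv i \<equiv> fgen (Sinv i)"

text \<open>A relation \<open>l = r\<close> is represented by the element \<open>l - r\<close>.\<close>

definition rels_zero :: "nat \<Rightarrow> sp_gen free_alg set" where
  "rels_zero n = {fs i j | i j. i \<in> {1..2*n} \<and> j \<in> {1..2*n} \<and>
                              ((even i \<and> j = i + 1) \<or> j \<ge> i + 2)}"

definition rels_inv :: "nat \<Rightarrow> sp_gen free_alg set" where
  "rels_inv n = {fs i (i+1) * fsinv i - 1 | i. i \<in> odds n} \<union>
                {fsinv i * fs i (i+1) - 1 | i. i \<in> odds n}"

definition rels_det :: "nat \<Rightarrow> complex \<Rightarrow> sp_gen free_alg set" where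
  "rels_det n q =
     {fs (i+1) (i+1) * fs i i - fconst (q^2) * fs (i+1) i * fs i (i+1) - fconst (q^3)
        | i. i \<in> odds n}"

definition rel_refl :: "complex \<Rightarrow> nat \<Rightarrow> nat \<Rightarrow> nat \<Rightarrow> nat \<Rightarrow> sp_gen free_alg" where
  "rel_refl q i a j b =
     (fconst (q ^ (of_bool (a = j) + of_bool (i = j))) * fs i a * fs j b
      - fconst (q ^ (of_bool (a = b) + of_bool (i = b))) * fs j b * fs i a)
     - (fconst ((q - inverse q) * q ^ of_bool (a = i) * (of_bool (b < a) - of_bool (i < j)))
          * fs j a * fs i b
        + fconst (q - inverse q) *
            (fconst (q ^ of_bool (a = b) * of_bool (b < i)) * fs j i * fs b a
             - fconst (q ^ of_bool (i = j) * of_bool (a < j)) * fs i j * fs a b)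
        + fconst ((q - inverse q)^2 * (of_bool (b < a \<and> a < i) - of_bool (a < i \<and> i < j)))
            * fs j i * fs a b)"

definition rels_refl :: "nat \<Rightarrow> complex \<Rightarrow> sp_gen free_alg set" where
  "rels_refl n q = {rel_refl q i a j b | i a j b.
     i \<in> {1..2*n} \<and> a \<in> {1..2*n} \<and> j \<in> {1..2*n} \<and> b \<in> {1..2*n}}"

definition sp_ideal :: "nat \<Rightarrow> complex \<Rightarrow> sp_gen free_alg set" where
  "sp_ideal n q = Idl\<^bsub>free_alg (sp_gens n)\<^esub>
     (rels_zero n \<union> rels_inv n \<union> rels_det n q \<union> rels_refl n q)"

text \<open>The algebra $U'_q(sp_{2n})$; its elements are the cosets of \<^const>\<open>sp_ideal\<close>.\<close>

type_synonym sp_elem = "sp_gen free_alg set"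

definition Uq_sp :: "nat \<Rightarrow> complex \<Rightarrow> sp_elem ring" where
  "Uq_sp n q = free_alg (sp_gens n) Quot sp_ideal n q"

definition sp_class :: "nat \<Rightarrow> complex \<Rightarrow> sp_gen free_alg \<Rightarrow> sp_elem" where
  "sp_class n q x = sp_ideal n q +>\<^bsub>free_alg (sp_gens n)\<^esub> x"

text \<open>
  A representation is a left module; the complex vector space structure is the restriction of
  the action along \<open>c \<mapsto> sp_class n q (fconst c)\<close>, which gives the scalar multiples of the unit.
\<close>

definition finite_dimensional :: "nat \<Rightarrow> complex \<Rightarrow> (sp_elem, 'v) module \<Rightarrow> bool" where
  "finite_dimensional n q V \<longleftrightarrow>
     (\<exists>B. finite B \<and> B \<subseteq> carrier V \<and>
        (\<forall>v\<in>carrier V. \<exists>c. v = (\<Oplus>\<^bsub>V\<^esub>b\<in>B. sp_class n q (fconst (c b)) \<odot>\<^bsub>V\<^esub> b)))"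


section \<open>Verma modules and their irreducible quotients\<close>

text \<open>
  A tuple $(\lambda_1, \lambda_3, \ldots, \lambda_{2n-1})$ is a function of which only the
  values on \<^const>\<open>odds\<close> matter.
\<close>

definition verma_ideal :: "nat \<Rightarrow> complex \<Rightarrow> (nat \<Rightarrow> complex) \<Rightarrow> sp_elem set" where
  "verma_ideal n q lam = left_ideal_gen (Uq_sp n q)
     ({sp_class n q (fs i j) | i j. i \<in> odds n \<and> j \<in> {1..i}} \<union>
      {sp_class n q (fs i (i+1) - fconst (lam i)) | i. i \<in> odds n})"

definition verma :: "nat \<Rightarrow> complex \<Rightarrow> (nat \<Rightarrow> complex) \<Rightarrow> (sp_elem, sp_elem set) module" where
  "verma n q lam = quotient_module (regular_module (Uq_sp n q)) (verma_ideal n q lam)"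

definition verma_vec :: "nat \<Rightarrow> complex \<Rightarrow> (nat \<Rightarrow> complex) \<Rightarrow> sp_elem set" where
  "verma_vec n q lam = verma_ideal n q lam +>\<^bsub>regular_module (Uq_sp n q)\<^esub> \<one>\<^bsub>Uq_sp n q\<^esub>"

definition irr_quotient ::
    "nat \<Rightarrow> complex \<Rightarrow> (nat \<Rightarrow> complex) \<Rightarrow> (sp_elem, sp_elem set set) module" where
  "irr_quotient n q lam = quotient_module (verma n q lam)
     (maximal_submodule_avoiding (Uq_sp n q) (verma n q lam) (verma_vec n q lam))"

end

theory Submission
  imports Defs "HOL-Computational_Algebra.Fundamental_Theorem_Algebra"
begin

text \<open>
  Relation (4) with $a = i + 1$, $i$ odd, says that $s_{i,i+1}$ commutes with every generator up to a
  power of $q$; this defines a weight grading by $\mathbb{Z}^n$.  Put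
  $K = \prod_k s_{2k-1,2k}^k$ (the element \<open>grading\<close>).  Since $q$ is not a root of unity, among the finitely many eigenvalues
  of $K$ on $V$ there is one, $\mu$, with no $\mu q^m$, $m > 0$, an eigenvalue.  A common eigenvector of
  the $s_{i,i+1}$ in that eigenspace is a highest weight vector, because the generators
  $s_{ij}$, $j \leq i$, $i$ odd, raise the $K$-weight.

  For the uniqueness of the maximal submodule of $M(\lambda)$ it suffices that the top
  $K$-eigenspace is spanned by $\xi$.  Relation (4) rewrites $s_{ia} s_{jb}$ with $i$ odd and $j$ even
  into products whose rows are either $(j, i)$ or have a smaller sum, so $M(\lambda)$ is spanned by
  words in even-row generators applied to $\xi$; these lower the weight, except for
  $s_{i+1,i}$, which relation (3) turns into a scalar on $\xi$.

  Modules are handled through annihilators: a vector of a module is replaced by its annihilator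
  in the free algebra, a left ideal containing the defining relations.
\<close>

section \<open>Left ideals and polynomial calculus in the free algebra\<close>

text \<open>\<open>irr_quotient\<close> rests on a definite description, so uniqueness of the
  maximal submodule of M(lambda) has to be established before V can be compared with it. Spanning
  words bound the top weight space from above, and M(lambda) is nonzero because it maps onto V. The
  exponents in K grow with k for a reason: with equal exponents s_{ij} with i odd and j < i even
  would have weight 0, whereas the growing ones make every such generator raise the weight strictly.
  Annihilators replace vectors so that computations happen in a type of class ring, where
  \<open>algebra_simps\<close> applies without carrier conditions; an eigenvector equation becomes
  membership of one element in a left ideal.\<close>

definition fscale :: "complex \<Rightarrow> 'x free_alg \<Rightarrow> 'x free_alg" (infixr "*\<^sub>F" 75) where
  "c *\<^sub>F x = fconst c * x"

lemma fconst_simps [simp]: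
  "fconst 0 = 0" "fconst 1 = 1"
  by (simp_all add: fconst_def)

lemma fconst_add: "fconst (a + b) = fconst a + fconst b"
  by (simp add: fconst_def single_add)

lemma fconst_mult: "fconst (a * b) = fconst a * fconst b"
  by (simp add: fconst_def mult_single)

lemma fconst_diff: "fconst (a - b) = fconst a - fconst b"
  by (metis add_diff_cancel_right' diff_add_cancel fconst_add)

lemma poly_mapping_sum_single:
  "x = (\<Sum>w\<in>Poly_Mapping.keys x. Poly_Mapping.single w (Poly_Mapping.lookup x w))"
  by (rule poly_mapping_eqI)
    (auto simp: lookup_sum lookup_single when_def in_keys_iff if_distrib sum.delta' cong: if_cong)

lemma fconst_commute: "x * fconst c = fconst c * x" for x :: "'x free_alg"
proof -
  have "Poly_Mapping.single w d * fconst c = fconst c * Poly_Mapping.single w d" for w :: "'x free_monoid" and d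
    by (simp add: fconst_def mult_single mult.commute)
  then show ?thesis
    by (subst (1 2) poly_mapping_sum_single[of x]) (simp add: sum_distrib_left sum_distrib_right)
qed

lemma fconst_mult_eq: "fconst c * x = c *\<^sub>F x" "x * fconst c = c *\<^sub>F x"
  by (simp_all add: fscale_def fconst_commute)

lemma fconst_eq: "fconst c = c *\<^sub>F 1"
  by (simp add: fscale_def)

text \<open>Constants are central, so scalars can always be moved to the front. As simp rules these
  leave to \<open>algebra_simps\<close> only the products of noncommuting elements.\<close>

lemma fscale_simps [simp]:
  "0 *\<^sub>F x = 0" "1 *\<^sub>F x = x" "c *\<^sub>F 0 = 0" "c *\<^sub>F d *\<^sub>F x = (c * d) *\<^sub>F x"
  "(c *\<^sub>F x) * y = c *\<^sub>F (x * y)" "x * (c *\<^sub>F y) = c *\<^sub>F (x * y)"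
  by (simp_all add: fscale_def fconst_mult mult.assoc)
    (metis fconst_commute mult.assoc)

lemma fscale_right_distrib: "c *\<^sub>F (x + y) = c *\<^sub>F x + c *\<^sub>F y"
  and fscale_right_diff: "c *\<^sub>F (x - y) = c *\<^sub>F x - c *\<^sub>F y"
  and fscale_left_distrib: "(c + d) *\<^sub>F x = c *\<^sub>F x + d *\<^sub>F x"
  and fscale_left_diff: "(c - d) *\<^sub>F x = c *\<^sub>F x - d *\<^sub>F x"
  by (simp_all add: fscale_def algebra_simps fconst_add fconst_diff)

lemmas fscale_algebra =
  fscale_right_distrib fscale_right_diff fscale_left_distrib fscale_left_diff

lemma fscale_sum_left: "(\<Sum>i\<in>A. a i) *\<^sub>F x = (\<Sum>i\<in>A. a i *\<^sub>F x)"
  by (induction A rule: infinite_finite_induct) (simp_all add: fscale_left_distrib)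

lemma fscale_sum_right: "a *\<^sub>F (\<Sum>i\<in>A. x i) = (\<Sum>i\<in>A. a *\<^sub>F x i)"
  by (simp add: fscale_def sum_distrib_left)

text \<open>Horner's scheme as in \<open>poly\<close>, whose argument has to come from a commutative
  semiring. Constants are central, so evaluation at \<open>T\<close> is still multiplicative
  (\<open>ev_mult\<close>).\<close>

definition ev :: "'x free_alg \<Rightarrow> complex poly \<Rightarrow> 'x free_alg" where
  "ev T p = fold_coeffs (\<lambda>a x. fconst a + T * x) p 0"

lemma ev_0 [simp]: "ev T 0 = 0"
  by (simp add: ev_def)

lemma ev_pCons [simp]: "ev T (pCons a p) = fconst a + T * ev T p"
  by (cases "a = 0 \<and> p = 0") (auto simp: ev_def fold_coeffs_pCons_coeff_not_0_eq
      fold_coeffs_pCons_not_0_0_eq)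

lemma ev_1 [simp]: "ev T 1 = 1"
  by (simp add: one_pCons)

lemma ev_add: "ev T (p + r) = ev T p + ev T r"
  by (induction p r rule: poly_induct2) (simp_all add: fconst_add algebra_simps)

lemma ev_smult: "ev T (smult c p) = c *\<^sub>F ev T p"
  by (induction p) (simp_all add: fconst_eq fscale_algebra)

lemma ev_mult: "ev T (p * r) = ev T p * ev T r"
  by (induction p) (simp_all add: ev_add ev_smult fconst_eq algebra_simps)

section \<open>Left ideals and eigenvectors modulo a left ideal\<close>

definition left_ideal :: "'a::ring_1 set \<Rightarrow> bool" where
  "left_ideal L \<longleftrightarrow> 0 \<in> L \<and> (\<forall>x\<in>L. \<forall>y\<in>L. x + y \<in> L) \<and> (\<forall>a. \<forall>x\<in>L. a * x \<in> L)"

lemma left_idealD: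
  assumes "left_ideal L"
  shows "0 \<in> L" "x \<in> L \<Longrightarrow> y \<in> L \<Longrightarrow> x + y \<in> L" "x \<in> L \<Longrightarrow> a * x \<in> L"
  using assms by (auto simp: left_ideal_def)

lemma left_ideal_minus:
  assumes "left_ideal L" "x \<in> L"
  shows "- x \<in> L"
  using left_idealD(3)[OF assms, of "-1"] by simp

lemma left_ideal_diff:
  assumes "left_ideal L" "x \<in> L" "y \<in> L"
  shows "x - y \<in> L"
  using left_idealD(2)[OF assms(1,2) left_ideal_minus[OF assms(1,3)]] by simp

lemma left_ideal_diff_cancel:
  assumes "left_ideal L" "x - y \<in> L"
  shows "x \<in> L \<longleftrightarrow> y \<in> L"
  using assms left_idealD(2)[of L "x - y" y] left_ideal_diff[of L x "x - y"] by auto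

lemma left_ideal_sum:
  assumes "left_ideal L" "\<And>b. b \<in> B \<Longrightarrow> x b \<in> L"
  shows "sum x B \<in> L"
  using assms by (induction B rule: infinite_finite_induct) (auto simp: left_idealD)

lemma left_ideal_fscale:
  assumes "left_ideal L" "x \<in> L"
  shows "c *\<^sub>F x \<in> L"
  using assms by (simp add: fscale_def left_idealD)

lemma left_ideal_fscale_cancel:
  assumes "left_ideal L" "c *\<^sub>F x \<in> L" "c \<noteq> 0"
  shows "x \<in> L"
  using left_ideal_fscale[OF assms(1,2), of "inverse c"] assms(3) by simp

text \<open>Modulo \<open>L\<close>, \<open>x\<close> is an eigenvector of left multiplication by
  \<open>T\<close>, and a polynomial in \<open>T\<close> acts on it by its value at
  \<open>r\<close>.\<close>

lemma left_ideal_ev_eigen: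
  assumes L: "left_ideal L" and x: "(T - fconst r) * x \<in> L"
  shows "ev T p * x - poly p r *\<^sub>F x \<in> L"
proof (induction p)
  case 0
  then show ?case using L by (simp add: left_idealD)
next
  case (pCons a p)
  have "ev T (pCons a p) * x - poly (pCons a p) r *\<^sub>F x
      = T * (ev T p * x - poly p r *\<^sub>F x) + poly p r *\<^sub>F ((T - fconst r) * x)"
    by (simp add: algebra_simps fconst_eq fscale_algebra)
  then show ?case
    using pCons x by (simp only: left_idealD[OF L] left_ideal_fscale[OF L])
qed

text \<open>Apply the linear factors of \<open>p\<close> to \<open>f\<close> one after another: the
  last vector outside \<open>L\<close> is an eigenvector. It is recorded as a polynomial in
  \<open>T\<close> applied to \<open>f\<close>, so that operators commuting with \<open>T\<close>
  keep the eigenvalues they had on \<open>f\<close>.\<close>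

lemma left_ideal_eigenvector:
  assumes L: "left_ideal L" and "f \<notin> L" "p \<noteq> 0" "ev T p * f \<in> L"
  shows "\<exists>r g. ev T g * f \<notin> L \<and> (T - fconst r) * (ev T g * f) \<in> L"
  using assms(2-)
proof (induction "degree p" arbitrary: p)
  case 0
  then obtain c where "p = [:c:]" "c \<noteq> 0"
    by (metis degree_eq_zeroE pCons_0_0)
  with 0 have "c *\<^sub>F f \<in> L" by (simp add: fconst_eq)
  with \<open>c \<noteq> 0\<close> \<open>f \<notin> L\<close> show ?case using left_ideal_fscale_cancel[OF L] by blast
next
  case (Suc d)
  then have "\<not> constant (poly p)" by (simp add: constant_degree)
  then obtain r where "poly p r = 0" using fundamental_theorem_of_algebra by blast
  then obtain p' where p: "p = [:-r, 1:] * p'" by (metis dvdE poly_eq_0_iff_dvd)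
  with Suc.prems have p'0: "p' \<noteq> 0" by auto
  have "ev T p = (T - fconst r) * ev T p'"
    by (simp only: p ev_mult) (simp add: fconst_def single_uminus algebra_simps)
  then have *: "(T - fconst r) * (ev T p' * f) \<in> L" using Suc.prems by (simp add: mult.assoc)
  show ?case
  proof (cases "ev T p' * f \<in> L")
    case True
    have "degree p = Suc (degree p')" using p'0 unfolding p by (subst degree_mult_eq) auto
    with Suc p'0 True show ?thesis by auto
  next
    case False
    with * show ?thesis by blast
  qed
qed

text \<open>Elimination with a pivot \<open>c k0 b\<close>: equation \<open>b\<close> expresses the
  unknown at \<open>k0\<close> by the others, and what remains has one equation and one unknown
  fewer.\<close>

lemma homogeneous_system_nontrivial:
  fixes c :: "'k \<Rightarrow> 'b \<Rightarrow> 'f::field"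
  assumes "finite B" "finite K" "card B < card K"
  shows "\<exists>x. (\<exists>k\<in>K. x k \<noteq> 0) \<and> (\<forall>b\<in>B. (\<Sum>k\<in>K. x k * c k b) = 0)"
  using assms
proof (induction B arbitrary: K c rule: finite_induct)
  case empty
  then show ?case by (intro exI[of _ "\<lambda>_. 1"]) (auto simp: card_gt_0_iff)
next
  case (insert b B)
  show ?case
  proof (cases "\<exists>k0\<in>K. c k0 b \<noteq> 0")
    case False
    then show ?thesis using insert.IH[of K c] insert by auto
  next
    case True
    then obtain k0 where k0: "k0 \<in> K" "c k0 b \<noteq> 0" by blast
    define K' where "K' = K - {k0}"
    have K: "K = insert k0 K'" "k0 \<notin> K'" "finite K'" using k0 insert.prems by (auto simp: K'_def)
    then have "card B < card K'" using insert by simp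
    \<comment> \<open>The coefficients of equation \<open>b'\<close> after substituting for the
      unknown at \<open>k0\<close>.\<close>
    from insert.IH[OF K(3) this, of "\<lambda>k b'. c k b' - c k b / c k0 b * c k0 b'"]
    obtain x where x: "\<exists>k\<in>K'. x k \<noteq> 0"
      "\<And>b'. b' \<in> B \<Longrightarrow> (\<Sum>k\<in>K'. x k * (c k b' - c k b / c k0 b * c k0 b')) = 0" by blast
    \<comment> \<open>The value at \<open>k0\<close> is the one forced by equation
      \<open>b\<close>.\<close>
    define y where "y = x(k0 := - (\<Sum>k\<in>K'. x k * c k b) / c k0 b)"
    have sum: "(\<Sum>k\<in>K. y k * c k b') = y k0 * c k0 b' + (\<Sum>k\<in>K'. x k * c k b')" for b'
    proof -
      have "(\<Sum>k\<in>K'. y k * c k b') = (\<Sum>k\<in>K'. x k * c k b')"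
        using K by (intro sum.cong) (auto simp: y_def)
      then show ?thesis using K by simp
    qed
    have "(\<Sum>k\<in>K. y k * c k b') = 0" if "b' \<in> B" for b'
    proof -
      have "(\<Sum>k\<in>K'. x k * (c k b' - c k b / c k0 b * c k0 b'))
          = (\<Sum>k\<in>K'. x k * c k b') - (\<Sum>k\<in>K'. x k * c k b) / c k0 b * c k0 b'"
        unfolding right_diff_distrib sum_subtractf sum_divide_distrib sum_distrib_right
        by (simp only: times_divide_eq_right times_divide_eq_left mult.assoc)
      then show ?thesis using x(2)[OF that] unfolding sum by (simp add: y_def)
    qed
    moreover have "(\<Sum>k\<in>K. y k * c k b) = 0"
      unfolding sum using k0 by (simp add: y_def)
    moreover have "\<exists>k\<in>K. y k \<noteq> 0" using x(1) K by (auto simp: y_def)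
    ultimately show ?thesis by blast
  qed
qed

text \<open>Finite dimensionality of the quotient by \<open>L\<close>, phrased through
  representatives in the free algebra.\<close>

definition cofinite_span :: "'x free_alg set \<Rightarrow> 'x free_alg set \<Rightarrow> bool" where
  "cofinite_span B L \<longleftrightarrow> finite B \<and> (\<forall>f. \<exists>c. f - (\<Sum>b\<in>B. c b *\<^sub>F b) \<in> L)"

lemma ev_powers_combination:
  "\<exists>p. ev T p = (\<Sum>k<N. x k *\<^sub>F T ^ k) \<and> (\<forall>k<N. coeff p k = x k)"
proof (induction N arbitrary: x)
  case 0
  show ?case by (intro exI[of _ 0]) simp
next
  case (Suc N)
  from Suc[of "\<lambda>k. x (Suc k)"] obtain p where
    p: "ev T p = (\<Sum>k<N. x (Suc k) *\<^sub>F T ^ k)" "\<forall>k<N. coeff p k = x (Suc k)" by blast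
  have "ev T (pCons (x 0) p) = (\<Sum>k<Suc N. x k *\<^sub>F T ^ k)"
    unfolding sum.lessThan_Suc_shift by (simp add: p sum_distrib_left fconst_eq)
  moreover have "\<forall>k<Suc N. coeff (pCons (x 0) p) k = x k"
    using p(2) by (simp add: coeff_pCons split: nat.split)
  ultimately show ?case by blast
qed

text \<open>One more power of \<open>T\<close> than there are spanning vectors: applied to
  \<open>g\<close>, these powers are linearly dependent modulo \<open>L\<close>, and the dependence
  gives the coefficients of \<open>p\<close>.\<close>

lemma annihilating_poly_vector:
  assumes L: "left_ideal L" and B: "cofinite_span B L"
  shows "\<exists>p. p \<noteq> 0 \<and> ev T p * g \<in> L"
proof -
  define N where "N = Suc (card B)"
  have "\<forall>k. \<exists>c. T ^ k * g - (\<Sum>b\<in>B. c b *\<^sub>F b) \<in> L"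
    using B unfolding cofinite_span_def by blast
  from choice[OF this] obtain c where
    c: "\<forall>k. T ^ k * g - (\<Sum>b\<in>B. c k b *\<^sub>F b) \<in> L" by blast
  obtain x where x: "\<exists>k\<in>{..<N}. x k \<noteq> 0" "\<forall>b\<in>B. (\<Sum>k<N. x k * c k b) = 0"
    using homogeneous_system_nontrivial[of B "{..<N}" c] B
    by (auto simp: cofinite_span_def N_def)
  obtain p where p: "ev T p = (\<Sum>k<N. x k *\<^sub>F T ^ k)" "\<forall>k<N. coeff p k = x k"
    using ev_powers_combination by blast
  have "(\<Sum>k<N. \<Sum>b\<in>B. (x k * c k b) *\<^sub>F b) = (\<Sum>b\<in>B. (\<Sum>k<N. x k * c k b) *\<^sub>F b)"
    by (subst sum.swap) (simp add: fscale_sum_left)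
  also have "\<dots> = 0" using x(2) by simp
  finally have "ev T p * g = (\<Sum>k<N. x k *\<^sub>F (T ^ k * g - (\<Sum>b\<in>B. c k b *\<^sub>F b)))"
    by (simp add: p sum_distrib_right fscale_algebra sum_subtractf fscale_sum_right)
  then have "ev T p * g \<in> L"
    using c by (simp only: left_ideal_sum[OF L] left_ideal_fscale[OF L])
  moreover have "p \<noteq> 0" using x(1) p(2) by force
  ultimately show ?thesis by blast
qed

text \<open>Polynomials in \<open>T\<close> commute, so the product of the polynomials that kill the
  members of \<open>B\<close> kills their whole span.\<close>

lemma annihilating_poly:
  assumes L: "left_ideal L" and B: "cofinite_span B L"
  shows "\<exists>p. p \<noteq> 0 \<and> (\<forall>f. ev T p * f \<in> L)"
proof -
  from annihilating_poly_vector[OF assms] obtain P where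
    P: "\<And>g. P g \<noteq> 0" "\<And>g. ev T (P g) * g \<in> L" by metis
  define p where "p = (\<Prod>b\<in>B. P b)"
  have fin: "finite B" using B by (simp add: cofinite_span_def)
  have pb: "ev T p * b \<in> L" if "b \<in> B" for b
  proof -
    \<comment> \<open>The factor belonging to \<open>b\<close> goes to the right, next to
      \<open>b\<close>.\<close>
    have "p = (\<Prod>b\<in>B - {b}. P b) * P b"
      using fin that by (simp add: p_def prod.remove mult.commute)
    then show ?thesis using P(2)[of b] by (simp add: ev_mult mult.assoc left_idealD[OF L])
  qed
  have "ev T p * f \<in> L" for f
  proof -
    from B obtain c where c: "f - (\<Sum>b\<in>B. c b *\<^sub>F b) \<in> L" unfolding cofinite_span_def by blast
    have "ev T p * f - (\<Sum>b\<in>B. c b *\<^sub>F (ev T p * b)) \<in> L"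
      using left_idealD(3)[OF L c, of "ev T p"] by (simp add: right_diff_distrib sum_distrib_left)
    moreover have "(\<Sum>b\<in>B. c b *\<^sub>F (ev T p * b)) \<in> L"
      by (intro left_ideal_sum[OF L] left_ideal_fscale[OF L] pb)
    ultimately show ?thesis using left_ideal_diff_cancel[OF L] by blast
  qed
  moreover have "p \<noteq> 0" using fin P(1) by (simp add: p_def)
  ultimately show ?thesis by blast
qed

section \<open>Weights\<close>

text \<open>The weight of an index for the torus element s_{i,i+1}, which q-commutes with s_{jb}
  with exponent \<open>eps i j + eps i b\<close> (\<open>torus_qcomm_generator\<close>).\<close>

definition eps :: "nat \<Rightarrow> nat \<Rightarrow> int" where
  "eps i j = of_bool (j = i) - of_bool (j = i + 1)"

fun letter_eps :: "nat \<Rightarrow> sp_gen \<Rightarrow> int" where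
  "letter_eps i (S j b) = eps i j + eps i b"
| "letter_eps i (Sinv j) = 0"

text \<open>The weight of an index for K: k for 2k-1 and -k for 2k. Its absolute value never
  decreases along the indices, so in s_{ij} with j <= i the row decides the sign; only s_{2k,2k-1}
  gets weight 0.\<close>

definition height :: "nat \<Rightarrow> int" where
  "height j = (if odd j then int ((j + 1) div 2) else - int (j div 2))"

fun letter_height :: "sp_gen \<Rightarrow> int" where
  "letter_height (S j b) = height j + height b"
| "letter_height (Sinv j) = 0"

text \<open>Every index belongs to exactly one pair 2k+1, 2k+2, so at most one summand is nonzero.
  The value 0 beyond 2n carries the induction on \<open>n\<close>.\<close>

lemma sum_eps_eq_height:
  assumes "1 \<le> j"
  shows "(\<Sum>k<n. int (k + 1) * eps (2 * k + 1) j) = (if j \<le> 2 * n then height j else 0)"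
proof (induction n)
  case 0
  then show ?case using assms by simp
next
  case (Suc n)
  consider "j \<le> 2 * n" | "j = 2 * n + 1" | "j = 2 * n + 2" | "j > 2 * n + 2" by linarith
  then show ?case
    unfolding sum.lessThan_Suc Suc by cases (auto simp: eps_def height_def)
qed

text \<open>\<open>J\<close> stands for the kernel of the map onto the algebra. Letters outside the
  index range lie in it, so later statements can range over all letters and words of the
  type.\<close>

locale sp_relations =
  fixes n :: nat and q :: complex and J :: "sp_gen free_alg set"
  assumes q_nz: "q \<noteq> 0"
    and q_not_root_of_unity: "\<And>k::nat. k > 0 \<Longrightarrow> q ^ k \<noteq> 1"
    and J_left_ideal: "left_ideal J"
    and J_right: "x \<in> J \<Longrightarrow> x * a \<in> J"
    and J_rels: "rels_zero n \<union> rels_inv n \<union> rels_det n q \<union> rels_refl n q \<subseteq> J"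
    and J_gens: "g \<notin> sp_gens n \<Longrightarrow> fgen g \<in> J"
begin

lemmas J_closed = left_idealD[OF J_left_ideal] left_ideal_diff[OF J_left_ideal]
  left_ideal_minus[OF J_left_ideal] left_ideal_fscale[OF J_left_ideal] J_right

lemma q_powi_neq_1: "e \<noteq> 0 \<Longrightarrow> q powi e \<noteq> 1"
  using q_not_root_of_unity[of "nat e"] q_not_root_of_unity[of "nat (- e)"]
  by (cases "e > 0") (auto simp: power_int_def power_inverse)

lemma s_zero:
  assumes "i \<in> {1..2*n}" "j \<in> {1..2*n}" "j > i" "\<not> (odd i \<and> j = i + 1)"
  shows "fs i j \<in> J"
proof -
  have "fs i j \<in> rels_zero n"
    using assms unfolding rels_zero_def by force
  then show ?thesis using J_rels by blast
qed

text \<open>Every scalar of relation (4) is collected in front of its product, so that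
  \<open>triangular_inversion\<close> can match the relation term by term.\<close>

lemma refl_relation:
  assumes "i \<in> {1..2*n}" "a \<in> {1..2*n}" "j \<in> {1..2*n}" "b \<in> {1..2*n}"
  shows "q ^ (of_bool (a = j) + of_bool (i = j)) *\<^sub>F (fs i a * fs j b)
      - q ^ (of_bool (a = b) + of_bool (i = b)) *\<^sub>F (fs j b * fs i a)
      - ((q - inverse q) * q ^ of_bool (a = i) * (of_bool (b < a) - of_bool (i < j)))
          *\<^sub>F (fs j a * fs i b)
      - ((q - inverse q) * (q ^ of_bool (a = b) * of_bool (b < i))) *\<^sub>F (fs j i * fs b a)
      + ((q - inverse q) * (q ^ of_bool (i = j) * of_bool (a < j))) *\<^sub>F (fs i j * fs a b)
      - ((q - inverse q)^2 * (of_bool (b < a \<and> a < i) - of_bool (a < i \<and> i < j)))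
          *\<^sub>F (fs j i * fs a b) \<in> J" (is "?x \<in> J")
proof -
  have "rel_refl q i a j b \<in> J"
    using assms J_rels unfolding rels_refl_def by blast
  also have "rel_refl q i a j b = ?x"
    unfolding rel_refl_def fconst_mult_eq by (simp add: fscale_right_diff algebra_simps)
  finally show ?thesis .
qed

section \<open>Commutation with the torus up to powers of q\<close>

definition torus_letter :: "sp_gen \<Rightarrow> bool" where
  "torus_letter g \<longleftrightarrow> (\<exists>i\<in>odds n. g = S i (i + 1) \<or> g = Sinv i)"

text \<open>The exponent is additive under products in either argument, so the weight of a word is
  the sum over its letters.\<close>

definition qcomm :: "int \<Rightarrow> sp_gen free_alg \<Rightarrow> sp_gen free_alg \<Rightarrow> bool" where
  "qcomm e x y \<longleftrightarrow> x * y - q powi e *\<^sub>F (y * x) \<in> J"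

lemma qcomm_J: "y \<in> J \<Longrightarrow> qcomm e x y"
  by (simp add: qcomm_def J_closed)

lemma qcomm_mult_left:
  assumes "qcomm e x y" "qcomm e' x' y"
  shows "qcomm (e + e') (x * x') y"
proof -
  have "x * (x' * y - q powi e' *\<^sub>F (y * x')) + q powi e' *\<^sub>F ((x * y - q powi e *\<^sub>F (y * x)) * x') \<in> J"
    using assms unfolding qcomm_def by (simp only: J_closed)
  then show ?thesis
    by (simp add: qcomm_def algebra_simps fscale_algebra power_int_add q_nz)
qed

lemma qcomm_mult_right:
  assumes "qcomm e x y" "qcomm e' x y'"
  shows "qcomm (e + e') x (y * y')"
proof -
  have "(x * y - q powi e *\<^sub>F (y * x)) * y' + q powi e *\<^sub>F (y * (x * y' - q powi e' *\<^sub>F (y' * x))) \<in> J"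
    using assms unfolding qcomm_def by (simp only: J_closed)
  then show ?thesis
    by (simp add: qcomm_def algebra_simps fscale_algebra power_int_add q_nz)
qed

lemma qcomm_1: "qcomm 0 1 y" "qcomm 0 x 1"
  by (simp_all add: qcomm_def J_closed)

text \<open>Multiplying x y = q^e y x by x' on both sides yields y x' = q^e x' y.\<close>

lemma qcomm_inverse:
  assumes "qcomm e x y" "x * x' - 1 \<in> J" "x' * x - 1 \<in> J"
  shows "qcomm (- e) x' y"
proof -
  have "(- (q powi (-e))) *\<^sub>F (x' * (x * y - q powi e *\<^sub>F (y * x)) * x')
      + q powi (-e) *\<^sub>F ((x' * x - 1) * (y * x'))
      - x' * y * (x * x' - 1) \<in> J"
    using assms unfolding qcomm_def by (simp only: J_closed)
  also have "(- (q powi (-e))) *\<^sub>F (x' * (x * y - q powi e *\<^sub>F (y * x)) * x')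
      + q powi (-e) *\<^sub>F ((x' * x - 1) * (y * x'))
      - x' * y * (x * x' - 1) = x' * y - q powi (-e) *\<^sub>F (y * x')"
    using q_nz by (simp add: algebra_simps fscale_algebra power_int_minus)
      (simp add: fscale_def fconst_def single_uminus)
  finally show ?thesis by (simp add: qcomm_def)
qed

lemma qcomm_sym: "qcomm 0 x y \<Longrightarrow> qcomm 0 y x"
  unfolding qcomm_def using J_closed(5)[of "x * y - y * x"] by simp

text \<open>In relation (4) with a = i + 1 the terms in s_{ji} s_{ba} and s_{ij} s_{ab} vanish: the
  deltas of the linear ones force a factor that is zero by relation (1), and the deltas of the
  quadratic one contradict a = i + 1. The remaining term in s_{ja} s_{ib} vanishes or merges with
  one of the two products on the left side.\<close>

lemma torus_qcomm_generator:
  assumes i: "i \<in> odds n" and j: "j \<in> {1..2*n}" and b: "b \<in> {1..2*n}"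
  shows "qcomm (eps i j + eps i b) (fs i (i + 1)) (fs j b)"
proof (cases "b \<le> j \<or> (odd j \<and> b = j + 1)")
  case False
  then have "fs j b \<in> J" using j b by (intro s_zero) auto
  then show ?thesis by (rule qcomm_J)
next
  case nz: True
  let ?a = "i + 1"
  have i': "odd i" "i \<in> {1..2*n}" "?a \<in> {1..2*n}" using i by (auto simp: odds_def elim: oddE)
  let ?r = "q ^ (of_bool (?a = j) + of_bool (i = j)) *\<^sub>F (fs i ?a * fs j b)
      - q ^ (of_bool (?a = b) + of_bool (i = b)) *\<^sub>F (fs j b * fs i ?a)
      - ((q - inverse q) * (of_bool (b < ?a) - of_bool (i < j))) *\<^sub>F (fs j ?a * fs i b)"
  have t3: "((q - inverse q) * (q ^ of_bool (?a = b) * of_bool (b < i))) *\<^sub>F (fs j i * fs b ?a) \<in> J"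
    (is "?t3 \<in> J")
  proof (cases "b < i")
    case True
    then have "fs b ?a \<in> J" using b i' by (intro s_zero) auto
    then show ?thesis by (simp add: J_closed)
  qed (simp add: J_closed)
  have t4: "((q - inverse q) * (q ^ of_bool (i = j) * of_bool (?a < j))) *\<^sub>F (fs i j * fs ?a b) \<in> J"
    (is "?t4 \<in> J")
  proof (cases "?a < j")
    case True
    then have "fs i j \<in> J" using j i' by (intro s_zero) auto
    then show ?thesis by (simp add: J_closed)
  qed (simp add: J_closed)
  have "?r - ?t3 + ?t4 \<in> J"
    using refl_relation[OF i'(2,3) j b] by simp
  from J_closed(4)[OF J_closed(2)[OF this t3] t4] have r: "?r \<in> J" by simp
  \<comment> \<open>Case 2 compares an element with itself. The third term merges with the first
    product in case 1 and with the second in case 5, has coefficient 0 in case 4 and a vanishing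
    factor in cases 3 and 6.\<close>
  consider "j = i" "b \<le> i" | "j = i" "b = i + 1" | "j < i" "b < i" | "j > i" "b \<le> i"
    | "j > i" "b = i + 1" | "j > i + 1" "b > i + 1"
  proof -
    have "b < i" if "j < i"
    proof -
      \<comment> \<open>Parity: b = i > j would require b = j + 1 with j odd, but i is odd.\<close>
      have "b \<noteq> i" using nz i'(1) that by auto
      then show ?thesis using nz that by linarith
    qed
    moreover have "j > i + 1" if "j > i" "b > i + 1"
      using nz i'(1) that by (cases "j = i + 1") auto
    moreover have "b \<le> i \<or> b = i + 1" if "j = i" using nz that by auto
    ultimately have "(j = i \<and> b \<le> i) \<or> (j = i \<and> b = i + 1) \<or> (j < i \<and> b < i) \<or> (j > i \<and> b \<le> i)
        \<or> (j > i \<and> b = i + 1) \<or> (j > i + 1 \<and> b > i + 1)" by arith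
    then show ?thesis using that by blast
  qed
  then show ?thesis
  proof cases
    case 1
    have "q *\<^sub>F ?r \<in> J" using r by (rule J_closed)
    also have "q *\<^sub>F ?r = fs i ?a * fs j b - q powi (eps i j + eps i b) *\<^sub>F (fs j b * fs i ?a)"
      using 1 q_nz by (cases "b = i")
        (auto simp: eps_def fscale_algebra algebra_simps power2_eq_square)
    finally show ?thesis by (simp add: qcomm_def)
  next
    case 2
    then show ?thesis by (simp add: eps_def qcomm_def J_closed)
  next
    case 3
    have "fs j ?a \<in> J" using 3 j i' by (intro s_zero) auto
    then have "((q - inverse q) * (of_bool (b < ?a) - of_bool (i < j))) *\<^sub>F (fs j ?a * fs i b) \<in> J"
      by (simp add: J_closed)
    from J_closed(2)[OF r this] show ?thesis using 3 by (simp add: eps_def qcomm_def)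
  next
    case 4
    have "q powi (- of_bool (j = ?a)) *\<^sub>F ?r \<in> J" using r by (rule J_closed)
    also have "q powi (- of_bool (j = ?a)) *\<^sub>F ?r
        = fs i ?a * fs j b - q powi (eps i j + eps i b) *\<^sub>F (fs j b * fs i ?a)"
      using 4 q_nz by (cases "b = i"; cases "j = ?a")
        (auto simp: eps_def fscale_algebra algebra_simps power_int_minus)
    finally show ?thesis by (simp add: qcomm_def)
  next
    case 5
    have "q powi (- of_bool (j = ?a)) *\<^sub>F ?r \<in> J" using r by (rule J_closed)
    also have "q powi (- of_bool (j = ?a)) *\<^sub>F ?r
        = fs i ?a * fs j b - q powi (eps i j + eps i b) *\<^sub>F (fs j b * fs i ?a)"
      using 5 q_nz by (cases "j = ?a")
        (auto simp: eps_def fscale_algebra algebra_simps power_int_minus power2_eq_square)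
    finally show ?thesis by (simp add: qcomm_def)
  next
    case 6
    have "fs i b \<in> J" using 6 b i' by (intro s_zero) auto
    then have "((q - inverse q) * (of_bool (b < ?a) - of_bool (i < j))) *\<^sub>F (fs j ?a * fs i b) \<in> J"
      by (simp add: J_closed)
    from J_closed(2)[OF r this] show ?thesis using 6 by (simp add: eps_def qcomm_def)
  qed
qed

lemma Sinv_inverse:
  assumes "i \<in> odds n"
  shows "fs i (i+1) * fsinv i - 1 \<in> J" "fsinv i * fs i (i+1) - 1 \<in> J"
proof -
  have "fs i (i+1) * fsinv i - 1 \<in> rels_inv n" "fsinv i * fs i (i+1) - 1 \<in> rels_inv n"
    using assms unfolding rels_inv_def by blast+
  then show "fs i (i+1) * fsinv i - 1 \<in> J" "fsinv i * fs i (i+1) - 1 \<in> J"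
    using J_rels by blast+
qed

lemma torus_qcomm_letter:
  assumes "i \<in> odds n"
  shows "qcomm (letter_eps i g) (fs i (i + 1)) (fgen g)"
proof (cases "g \<in> sp_gens n")
  case False
  then show ?thesis by (simp add: J_gens qcomm_J)
next
  case True
  then consider j b where "g = S j b" "j \<in> {1..2*n}" "b \<in> {1..2*n}" | j where "g = Sinv j" "j \<in> odds n"
    by (auto simp: sp_gens_def)
  then show ?thesis
  proof cases
    case 1
    then show ?thesis using torus_qcomm_generator assms by simp
  next
    case 2
    have "i \<in> {1..2*n}" "i + 1 \<in> {1..2*n}" "odd i" "odd j"
      using assms 2 by (auto simp: odds_def elim: oddE)
    then have "qcomm 0 (fs j (j + 1)) (fs i (i + 1))"
      using torus_qcomm_generator[OF 2(2), of i "i + 1"]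
      by (cases "i = j"; cases "Suc i = j"; cases "i = Suc j") (auto simp: eps_def)
    then have "qcomm 0 (fsinv j) (fs i (i + 1))"
      using qcomm_inverse[of 0] Sinv_inverse[OF 2(2)] by force
    then show ?thesis using 2 qcomm_sym by simp
  qed
qed

lemma torus_letter_qcomm:
  assumes "torus_letter g"
  shows "\<exists>e. qcomm e (fgen g) (fgen h)"
proof -
  from assms obtain i where i: "i \<in> odds n" "g = S i (i + 1) \<or> g = Sinv i"
    by (auto simp: torus_letter_def)
  then show ?thesis
    using torus_qcomm_letter[OF i(1), of h] qcomm_inverse[OF _ Sinv_inverse[OF i(1)]] by blast
qed

definition grading :: "sp_gen free_alg" where
  "grading = prod_list (map (\<lambda>k. fs (2*k+1) (2*k+2) ^ (k+1)) [0..<n])"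

lemma qcomm_power_left: "qcomm e x y \<Longrightarrow> qcomm (int k * e) (x ^ k) y"
proof (induction k)
  case (Suc k)
  then have "qcomm (e + int k * e) (x * x ^ k) y" by (intro qcomm_mult_left)
  then show ?case by (simp add: algebra_simps)
qed (simp add: qcomm_1)

lemma odds_eq: "odds n = (\<lambda>k. 2 * k + 1) ` {..<n}"
  by (auto simp: odds_def image_iff elim!: oddE)

lemma grading_qcomm_letter: "qcomm (letter_height g) grading (fgen g)"
proof (cases "g \<in> sp_gens n")
  case False
  then show ?thesis by (simp add: J_gens qcomm_J)
next
  case True
  have *: "qcomm (\<Sum>k<m. int (k + 1) * letter_eps (2*k+1) g)
      (prod_list (map (\<lambda>k. fs (2*k+1) (2*k+2) ^ (k+1)) [0..<m])) (fgen g)" if "m \<le> n" for m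
    using that
  proof (induction m)
    case (Suc m)
    have "qcomm (int (m + 1) * letter_eps (2*m+1) g) (fs (2*m+1) (2*m+2) ^ (m+1)) (fgen g)"
      using torus_qcomm_letter[of "2*m+1" g] Suc.prems
      by (intro qcomm_power_left) (auto simp: odds_eq)
    from qcomm_mult_left[OF Suc.IH this] Suc.prems show ?case by simp
  qed (simp add: qcomm_1)
  have "(\<Sum>k<n. int (k + 1) * letter_eps (2*k+1) g) = letter_height g"
  proof (cases g)
    case (S j b)
    then have "j \<in> {1..2*n}" "b \<in> {1..2*n}" using True by (auto simp: sp_gens_def)
    then show ?thesis
      using sum_eps_eq_height[of j n] sum_eps_eq_height[of b n]
      by (simp add: S distrib_left sum.distrib)
  qed simp
  with *[of n] show ?thesis by (simp add: grading_def)
qed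

lemma grading_qcomm_torus:
  assumes "i \<in> odds n"
  shows "qcomm 0 grading (fs i (i + 1))"
  using grading_qcomm_letter[of "S i (i + 1)"] assms by (auto simp: height_def odds_def)

end

context sp_relations
begin

section \<open>Existence of a highest weight vector\<close>

lemma commutes_ev:
  assumes "x * t - t * x \<in> J"
  shows "x * ev t g - ev t g * x \<in> J"
proof (induction g)
  case (pCons a g)
  have "x * ev t (pCons a g) - ev t (pCons a g) * x
      = (x * t - t * x) * ev t g + t * (x * ev t g - ev t g * x)"
    by (simp add: algebra_simps fconst_eq)
  also have "\<dots> \<in> J" using assms pCons by (simp only: J_closed)
  finally show ?case .
qed (simp add: J_closed)

text \<open>As \<open>t\<close> commutes with \<open>x\<close> modulo \<open>J\<close>, polynomials
  in \<open>t\<close> preserve the eigenspaces of \<open>x\<close>.\<close>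

lemma eigenvector_ev:
  assumes L: "left_ideal L" "J \<subseteq> L" and "qcomm 0 x t" and f: "(x - fconst r) * f \<in> L"
  shows "(x - fconst r) * (ev t g * f) \<in> L"
proof -
  have "(x * ev t g - ev t g * x) * f \<in> L"
    using J_right[OF commutes_ev] assms by (auto simp: qcomm_def)
  moreover have "ev t g * ((x - fconst r) * f) \<in> L"
    using f by (rule left_idealD(3)[OF L(1)])
  ultimately have "(x * ev t g - ev t g * x) * f + ev t g * ((x - fconst r) * f) \<in> L" (is "?e \<in> _")
    by (rule left_idealD(2)[OF L(1)])
  also have "?e = (x - fconst r) * (ev t g * f)"
    by (simp add: algebra_simps fconst_eq)
  finally show ?thesis by (simp add: algebra_simps)
qed

text \<open>Left multiplication by \<open>x\<close> acts on the quotient by the left ideal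
  \<open>L\<close>, where the elements outside \<open>L\<close> are the nonzero vectors.\<close>

definition eigenvalues :: "sp_gen free_alg \<Rightarrow> sp_gen free_alg set \<Rightarrow> complex set" where
  "eigenvalues x L = {r. \<exists>f. f \<notin> L \<and> (x - fconst r) * f \<in> L}"

lemma finite_eigenvalues:
  assumes L: "left_ideal L" and "cofinite_span B L"
  shows "finite (eigenvalues x L)"
proof -
  obtain p where p: "p \<noteq> 0" "\<And>f. ev x p * f \<in> L"
    using annihilating_poly[OF assms] by blast
  have "eigenvalues x L \<subseteq> {r. poly p r = 0}"
  proof (clarsimp simp: eigenvalues_def)
    fix r f assume f: "f \<notin> L" "(x - fconst r) * f \<in> L"
    have "poly p r *\<^sub>F f \<in> L"
      using left_ideal_ev_eigen[OF L f(2), of p] p(2)[of f] left_ideal_diff_cancel[OF L] by blast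
    then show "poly p r = 0" using left_ideal_fscale_cancel[OF L] f(1) by blast
  qed
  with p(1) show ?thesis using poly_roots_finite finite_subset by blast
qed

lemma eigenvector_obtain:
  assumes L: "left_ideal L" and "cofinite_span B L" "f \<notin> L"
  obtains r g where "ev x g * f \<notin> L" "(x - fconst r) * (ev x g * f) \<in> L"
  using annihilating_poly[OF assms(1,2), of x] left_ideal_eigenvector[OF assms(1,3)] by blast

lemma eigenvalue_shift:
  assumes L: "left_ideal L" "J \<subseteq> L" and x: "qcomm e x y" and f: "(x - fconst r) * f \<in> L"
  shows "(x - fconst (r * q powi e)) * (y * f) \<in> L"
proof -
  have "(x * y - q powi e *\<^sub>F (y * x)) * f \<in> L"
    using J_right[OF x[unfolded qcomm_def]] L(2) by blast
  moreover have "q powi e *\<^sub>F (y * ((x - fconst r) * f)) \<in> L"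
    by (intro left_ideal_fscale[OF L(1)] left_idealD(3)[OF L(1) f])
  ultimately have "(x * y - q powi e *\<^sub>F (y * x)) * f + q powi e *\<^sub>F (y * ((x - fconst r) * f)) \<in> L" (is "?e \<in> _")
    by (rule left_idealD(2)[OF L(1)])
  also have "?e = (x - fconst (r * q powi e)) * (y * f)"
    by (simp add: algebra_simps fconst_eq fscale_algebra)
  finally show ?thesis .
qed

text \<open>Start at any \<open>r0\<close> in \<open>E\<close>. Since q is not a root of unity and
  \<open>r0\<close> is nonzero, the numbers r0 q^m are distinct, so only finitely many lie in
  \<open>E\<close>; the largest such m gives the element sought.\<close>

lemma maximal_eigenvalue:
  assumes "finite E" "E \<noteq> {}" "0 \<notin> E"
  shows "\<exists>r\<in>E. \<forall>m>0. r * q powi m \<notin> E"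
proof -
  obtain r0 where r0: "r0 \<in> E" using assms by blast
  have inj: "inj (\<lambda>m::nat. r0 * q powi m)"
  proof (rule injI)
    fix a b :: nat assume "r0 * q powi a = r0 * q powi b"
    then have "q powi (int a - int b) = 1"
      using assms r0 q_nz by (auto simp: power_int_diff)
    then show "a = b" using q_powi_neq_1[of "int a - int b"] by auto
  qed
  define M where "M = {m::nat. r0 * q powi m \<in> E}"
  have "finite M"
    unfolding M_def using finite_vimageI[OF assms(1) inj] by (simp add: vimage_def)
  moreover have "M \<noteq> {}" using r0 by (auto simp: M_def intro: exI[of _ 0])
  ultimately have max: "Max M \<in> M" "\<And>m. m \<in> M \<Longrightarrow> m \<le> Max M" by (auto intro: Max_in)
  have "r0 * q powi int (Max M) * q powi m \<notin> E" if "m > 0" for m :: int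
  proof
    assume "r0 * q powi int (Max M) * q powi m \<in> E"
    moreover have "int (Max M + nat m) = int (Max M) + m" using that by simp
    ultimately have "r0 * q powi int (Max M + nat m) \<in> E"
      using q_nz by (simp only: power_int_add mult.assoc simp_thms)
    then have "Max M + nat m \<in> M" unfolding M_def by blast
    with max(2)[OF this] that show False by simp
  qed
  with max(1) show ?thesis by (auto simp: M_def)
qed

lemma torus_invertible:
  assumes L: "left_ideal L" "J \<subseteq> L" and "i \<in> odds n" "fs i (i + 1) * f \<in> L"
  shows "f \<in> L"
proof -
  have "fsinv i * (fs i (i + 1) * f) \<in> L"
    using assms(4) by (rule left_idealD(3)[OF L(1)])
  moreover have "(fsinv i * fs i (i + 1) - 1) * f \<in> L"
    using J_right Sinv_inverse[OF assms(3)] L by blast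
  ultimately have "fsinv i * (fs i (i + 1) * f) - (fsinv i * fs i (i + 1) - 1) * f \<in> L"
    by (intro left_ideal_diff L)
  then show ?thesis by (simp add: algebra_simps)
qed

text \<open>This excludes 0 as an eigenvalue of K, as \<open>maximal_eigenvalue\<close>
  requires.\<close>

lemma grading_invertible:
  assumes L: "left_ideal L" "J \<subseteq> L" and "grading * f \<in> L"
  shows "f \<in> L"
proof -
  have power: "f \<in> L" if "i \<in> odds n" "fs i (i + 1) ^ k * f \<in> L" for i k f
    using that(2) by (induction k) (use torus_invertible[OF L that(1)] in \<open>auto simp: mult.assoc\<close>)
  have "f \<in> L" if "prod_list (map (\<lambda>k. fs (2*k+1) (2*k+2) ^ (k+1)) [0..<m]) * f \<in> L" "m \<le> n" for m f
    using that
  proof (induction m arbitrary: f)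
    case (Suc m)
    then have "fs (2*m+1) (2*m+1+1) ^ (m+1) * f \<in> L"
      by (simp add: mult.assoc)
    then show ?case using power[of "2*m+1" "m+1"] Suc.prems by (simp add: odds_eq)
  qed simp
  with assms(3) show ?thesis unfolding grading_def by blast
qed

lemma common_eigenvector:
  assumes L: "left_ideal L" "J \<subseteq> L" and B: "cofinite_span B L" and "1 \<notin> L"
  shows "\<exists>f r. f \<notin> L \<and> (grading - fconst r) * f \<in> L
    \<and> (\<forall>m>0. r * q powi m \<notin> eigenvalues grading L)
    \<and> (\<forall>i\<in>odds n. \<exists>c. (fs i (i + 1) - fconst c) * f \<in> L)"
proof -
  have "eigenvalues grading L \<noteq> {}"
    using eigenvector_obtain[OF L(1) B \<open>1 \<notin> L\<close>, of grading] unfolding eigenvalues_def by blast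
  moreover have "0 \<notin> eigenvalues grading L"
    using grading_invertible[OF L] by (auto simp: eigenvalues_def)
  ultimately obtain r where r: "r \<in> eigenvalues grading L"
      "\<And>m. m > 0 \<Longrightarrow> r * q powi m \<notin> eigenvalues grading L"
    using maximal_eigenvalue finite_eigenvalues[OF L(1) B] by blast
  \<comment> \<open>One torus element is added at a time. The new vector is a polynomial in
    s_{j,j+1} applied to the old one, so the K-eigenvalue and the earlier torus eigenvalues
    survive.\<close>
  have "\<exists>f. f \<notin> L \<and> (grading - fconst r) * f \<in> L
      \<and> (\<forall>i\<in>I. \<exists>c. (fs i (i + 1) - fconst c) * f \<in> L)" if "finite I" "I \<subseteq> odds n" for I
    using that
  proof (induction I rule: finite_induct)
    case empty
    then show ?case using r(1) by (auto simp: eigenvalues_def)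
  next
    case (insert j I)
    then obtain f where f: "f \<notin> L" "(grading - fconst r) * f \<in> L"
      "\<And>i. i \<in> I \<Longrightarrow> \<exists>c. (fs i (i + 1) - fconst c) * f \<in> L" by auto
    obtain s g where g: "ev (fs j (j + 1)) g * f \<notin> L"
      "(fs j (j + 1) - fconst s) * (ev (fs j (j + 1)) g * f) \<in> L"
      using eigenvector_obtain[OF L(1) B f(1)] by metis
    have j: "j \<in> odds n" using insert by blast
    have "qcomm 0 (fs i (i + 1)) (fs j (j + 1))" if "i \<in> odds n" for i
      using torus_qcomm_letter[OF that, of "S j (j + 1)"] that j
      by (cases "i = j"; cases "Suc i = j"; cases "i = Suc j") (auto simp: eps_def odds_def)
    then have "\<exists>c. (fs i (i + 1) - fconst c) * (ev (fs j (j + 1)) g * f) \<in> L" if "i \<in> I" for i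
      using eigenvector_ev[OF L] f(3)[OF that] insert.prems that by blast
    moreover have "(grading - fconst r) * (ev (fs j (j + 1)) g * f) \<in> L"
      using eigenvector_ev[OF L grading_qcomm_torus[OF j] f(2)] .
    ultimately show ?case using g by blast
  qed
  moreover have "finite (odds n)" by (simp add: odds_eq)
  ultimately show ?thesis using r(2) by blast
qed

lemma raising_height:
  assumes "odd i" "j \<in> {1..i}"
  shows "letter_height (S i j) > 0"
  using assms by (auto simp: height_def elim!: oddE)

theorem highest_weight_vector:
  assumes L: "left_ideal L" "J \<subseteq> L" and B: "cofinite_span B L" and "1 \<notin> L"
  shows "\<exists>f lam. f \<notin> L \<and> (\<forall>i\<in>odds n. lam i \<noteq> 0
    \<and> (fs i (i + 1) - fconst (lam i)) * f \<in> L \<and> (\<forall>j\<in>{1..i}. fs i j * f \<in> L))"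
proof -
  obtain f r where f: "f \<notin> L" "(grading - fconst r) * f \<in> L"
      "\<And>m. m > 0 \<Longrightarrow> r * q powi m \<notin> eigenvalues grading L"
      "\<forall>i\<in>odds n. \<exists>c. (fs i (i + 1) - fconst c) * f \<in> L"
    using common_eigenvector[OF assms] by blast
  obtain lam where lam: "\<And>i. i \<in> odds n \<Longrightarrow> (fs i (i + 1) - fconst (lam i)) * f \<in> L"
    using bchoice[OF f(4)] by blast
  have "lam i \<noteq> 0" if "i \<in> odds n" for i
    using lam[OF that] torus_invertible[OF L that, of f] f(1) by auto
  moreover have "fs i j * f \<in> L" if "i \<in> odds n" "j \<in> {1..i}" for i j
  proof (rule ccontr)
    assume "fs i j * f \<notin> L"
    moreover have "(grading - fconst (r * q powi letter_height (S i j))) * (fs i j * f) \<in> L"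
      using eigenvalue_shift[OF L grading_qcomm_letter f(2)] .
    ultimately have "r * q powi letter_height (S i j) \<in> eigenvalues grading L"
      unfolding eigenvalues_def by blast
    then show False using f(3)[OF raising_height] that by (auto simp: odds_def)
  qed
  ultimately show ?thesis using f(1) lam by blast
qed

end

section \<open>The top weight space of a highest weight module\<close>

definition word :: "sp_gen list \<Rightarrow> sp_gen free_alg" where
  "word ws = prod_list (map fgen ws)"

lemma word_simps [simp]:
  "word [] = 1" "word (g # ws) = fgen g * word ws" "word (us @ ws) = word us * word ws"
  by (simp_all add: word_def)

lemma word_eq_single: "word ws = Poly_Mapping.single (FM ws) 1"
proof (induction ws)
  case Nil
  show ?case unfolding word_simps zero_free_monoid_def[symmetric] by simp
qed (simp add: fgen_def mult_single plus_free_monoid_def)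

lemma free_alg_word_induct:
  assumes "\<And>x y. P x \<Longrightarrow> P y \<Longrightarrow> P (x + y)" "\<And>c x. P x \<Longrightarrow> P (c *\<^sub>F x)" "\<And>ws. P (word ws)"
  shows "P x"
proof -
  have zero: "P 0" using assms(2)[OF assms(3), of 0] by simp
  have "P (Poly_Mapping.single w c)" for w c
    using assms(2)[OF assms(3), of c "letters w"]
    by (simp add: word_eq_single fscale_def fconst_def mult_single)
  then have "P (\<Sum>w\<in>W. Poly_Mapping.single w (f w))" for W f
    by (induction W rule: infinite_finite_induct) (simp_all add: zero assms(1))
  then show ?thesis by (subst poly_mapping_sum_single)
qed

text \<open>The value 0 for \<open>Sinv\<close> is a default: \<open>triangular_word\<close> looks
  at rows only when the torus letters and the letters in \<open>J\<close> are gone.\<close>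

fun row :: "sp_gen \<Rightarrow> nat" where
  "row (S i a) = i"
| "row (Sinv i) = 0"

fun row_inversions :: "sp_gen list \<Rightarrow> nat" where
  "row_inversions [] = 0"
| "row_inversions (g # ws)
    = (if odd (row g) then length (filter (\<lambda>h. even (row h)) ws) else 0) + row_inversions ws"

definition row_sum :: "sp_gen list \<Rightarrow> nat" where
  "row_sum ws = sum_list (map row ws)"

text \<open>Length pays for deleting a letter. When relation (4) rewrites s_{ia} s_{jb} with i odd
  and j even, the products with rows (j, i) keep the row sum and lose an inversion; the deltas at
  the other products make their row sums smaller.\<close>

definition word_order :: "(sp_gen list \<times> sp_gen list) set" where
  "word_order = measures [length, row_sum, row_inversions]"

lemma wf_word_order: "wf word_order"
  by (simp add: word_order_def)

lemma row_inversions_swap: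
  assumes "odd (row x)" "even (row y)" "row x' = row y" "row y' = row x"
  shows "row_inversions (us @ x' # y' # ws) < row_inversions (us @ x # y # ws)"
  by (induction us) (use assms in auto)

lemma word_order_intros:
  "length us < length ws \<Longrightarrow> (us, ws) \<in> word_order"
  "row x' + row y' < row x + row y \<Longrightarrow> (us @ x' # y' # ws, us @ x # y # ws) \<in> word_order"
  "odd (row x) \<Longrightarrow> even (row y) \<Longrightarrow> row x' = row y \<Longrightarrow> row y' = row x \<Longrightarrow>
    (us @ x' # y' # ws, us @ x # y # ws) \<in> word_order"
  using row_inversions_swap[of x y x' y' us ws] by (auto simp: word_order_def row_sum_def)

text \<open>Look at the last letter in an odd row: there is none, it ends the word, or an even row
  follows it.\<close>

lemma row_pattern_cases:
  obtains (even) "\<forall>g\<in>set ws. even (row g)"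
  | (last) us x where "ws = us @ [x]" "odd (row x)"
  | (inversion) us x y vs where "ws = us @ x # y # vs" "odd (row x)" "even (row y)"
proof (cases "\<exists>g\<in>set ws. odd (row g)")
  case True
  then obtain us x vs where *: "ws = us @ x # vs" "odd (row x)" "\<forall>g\<in>set vs. \<not> odd (row g)"
    using split_list_last_prop[of ws "\<lambda>g. odd (row g)"] by blast
  show ?thesis using * that by (cases vs) auto
qed (use that in auto)

text \<open>\<open>L\<close> abstracts the annihilator of \<xi> in M(lambda).\<close>

locale highest_weight_ideal = sp_relations +
  fixes L :: "sp_gen free_alg set" and lam :: "nat \<Rightarrow> complex"
  assumes L_left_ideal: "left_ideal L" and J_subset_L: "J \<subseteq> L"
    and lam_nz: "i \<in> odds n \<Longrightarrow> lam i \<noteq> 0"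
    and L_torus: "i \<in> odds n \<Longrightarrow> fs i (i + 1) - fconst (lam i) \<in> L"
    and L_raising: "i \<in> odds n \<Longrightarrow> j \<in> {1..i} \<Longrightarrow> fs i j \<in> L"
begin

lemmas L_closed = left_idealD[OF L_left_ideal] left_ideal_diff[OF L_left_ideal]
  left_ideal_minus[OF L_left_ideal] left_ideal_fscale[OF L_left_ideal]

lemma grading_eigenvalue: "\<exists>r. r \<noteq> 0 \<and> grading - fconst r \<in> L"
proof -
  have mult: "x * y - fconst (c * d) \<in> L" if "x - fconst c \<in> L" "y - fconst d \<in> L" for x y c d
  proof -
    have "x * (y - fconst d) + d *\<^sub>F (x - fconst c) \<in> L"
      using that by (simp only: L_closed)
    then show ?thesis by (simp add: algebra_simps fconst_eq fscale_algebra)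
  qed
  have "fs i (i + 1) ^ k - fconst (lam i ^ k) \<in> L" if "i \<in> odds n" for i k
  proof (induction k)
    case (Suc k)
    from mult[OF L_torus[OF that] this] show ?case by simp
  qed (simp add: L_closed)
  then have power: "\<exists>r. r \<noteq> 0 \<and> fs i (i + 1) ^ k - fconst r \<in> L" if "i \<in> odds n" for i k
    using lam_nz[OF that] that power_not_zero by blast
  have "\<exists>r. r \<noteq> 0 \<and> prod_list (map (\<lambda>k. fs (2*k+1) (2*k+2) ^ (k+1)) [0..<m]) - fconst r \<in> L"
    if "m \<le> n" for m
    using that
  proof (induction m)
    case 0
    then show ?case by (intro exI[of _ 1]) (simp add: L_closed)
  next
    case (Suc m)
    then obtain r where r: "r \<noteq> 0"
      "prod_list (map (\<lambda>k. fs (2*k+1) (2*k+2) ^ (k+1)) [0..<m]) - fconst r \<in> L" by auto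
    obtain s where s: "s \<noteq> 0" "fs (2*m+1) (2*m+2) ^ (m+1) - fconst s \<in> L"
      using power[of "2*m+1" "m+1"] Suc.prems by (auto simp: odds_eq)
    show ?case using mult[OF r(2) s(2)] r(1) s(1) by (intro exI[of _ "r * s"]) simp
  qed
  then show ?thesis unfolding grading_def by blast
qed

text \<open>The choice stands in for the explicit product of powers of \<open>lam i\<close>; later
  proofs rely on the two properties in the lemma \<open>top_weight\<close>.\<close>

definition top_weight :: complex where
  "top_weight = (SOME r. r \<noteq> 0 \<and> grading - fconst r \<in> L)"

lemma top_weight: "top_weight \<noteq> 0" "grading - fconst top_weight \<in> L"
  using someI_ex[OF grading_eigenvalue] by (simp_all add: top_weight_def)

text \<open>
  Stands for "\<open>x\<close> applied to the highest weight vector \<open>\<xi>\<close> is a multiple of \<open>\<xi>\<close> plus terms of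
  lower weight" without a decomposition into eigenspaces: the polynomial kills the lower terms.
\<close>

definition triangular :: "sp_gen free_alg \<Rightarrow> bool" where
  "triangular x \<longleftrightarrow> (\<exists>c p. poly p top_weight \<noteq> 0 \<and> ev grading p * (x - fconst c) \<in> L)"

lemma triangular_L: "x \<in> L \<Longrightarrow> triangular x"
  unfolding triangular_def by (intro exI[of _ 0] exI[of _ 1]) simp

lemma triangular_1: "triangular 1"
  unfolding triangular_def by (intro exI[of _ 1] exI[of _ 1]) (simp add: L_closed)

lemma triangular_fscale: "triangular x \<Longrightarrow> triangular (a *\<^sub>F x)"
proof -
  assume "triangular x"
  then obtain c p where p: "poly p top_weight \<noteq> 0" "ev grading p * (x - fconst c) \<in> L"
    by (auto simp: triangular_def)
  have "a *\<^sub>F (ev grading p * (x - fconst c)) \<in> L" (is "?e \<in> _") using p(2) by (rule L_closed)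
  also have "?e = ev grading p * (a *\<^sub>F x - fconst (a * c))"
    by (simp add: algebra_simps fconst_eq fscale_algebra)
  finally show ?thesis using p(1) unfolding triangular_def by blast
qed

text \<open>Polynomials in K commute, so \<open>p * r\<close> kills both error terms, and its value
  at the top weight is a product of nonzero numbers.\<close>

lemma triangular_add: "triangular x \<Longrightarrow> triangular y \<Longrightarrow> triangular (x + y)"
proof -
  assume "triangular x" "triangular y"
  then obtain c p d r where p: "poly p top_weight \<noteq> 0" "ev grading p * (x - fconst c) \<in> L"
    and r: "poly r top_weight \<noteq> 0" "ev grading r * (y - fconst d) \<in> L"
    by (auto simp: triangular_def)
  have "ev grading r * (ev grading p * (x - fconst c)) + ev grading p * (ev grading r * (y - fconst d)) \<in> L" (is "?e \<in> _")
    using p(2) r(2) by (simp only: L_closed)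
  also have "?e = ev grading (r * p) * (x - fconst c) + ev grading (p * r) * (y - fconst d)"
    by (simp only: ev_mult mult.assoc)
  also have "\<dots> = ev grading (p * r) * (x + y - fconst (c + d))"
    by (simp add: mult.commute[of r p] fconst_add algebra_simps)
  finally show ?thesis
    using p(1) r(1) unfolding triangular_def by (intro exI[of _ "c + d"] exI[of _ "p * r"]) simp
qed

lemma triangular_cong: "x - y \<in> L \<Longrightarrow> triangular y \<Longrightarrow> triangular x"
  using triangular_add[OF triangular_L, of "x - y" y] by simp

lemma triangular_diff: "triangular x \<Longrightarrow> triangular y \<Longrightarrow> triangular (x - y)"
  using triangular_add[of x "(-1) *\<^sub>F y"] triangular_fscale[of y "-1"]
  by (simp add: fscale_def fconst_def single_uminus)

text \<open>K acts on x \<xi> by r = top_weight q^e, and r differs from the top weight since q is no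
  root of unity. So the polynomial X - r serves, with c = 0.\<close>

lemma triangular_lower_weight:
  assumes "qcomm e grading x" "e \<noteq> 0"
  shows "triangular x"
proof -
  let ?r = "top_weight * q powi e"
  have "(grading - fconst ?r) * (x * 1) \<in> L"
    using eigenvalue_shift[OF L_left_ideal J_subset_L assms(1), of top_weight 1] top_weight by simp
  also have "(grading - fconst ?r) * (x * 1) = ev grading [:-?r, 1:] * (x - fconst 0)"
    by (simp add: fconst_def single_uminus algebra_simps)
  finally have "ev grading [:-?r, 1:] * (x - fconst 0) \<in> L" .
  moreover have "poly [:-?r, 1:] top_weight \<noteq> 0"
    using top_weight(1) q_powi_neq_1[OF assms(2)] by simp
  ultimately show ?thesis unfolding triangular_def by blast
qed

lemma grading_qcomm_word: "qcomm (sum_list (map letter_height ws)) grading (word ws)"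
  by (induction ws) (simp_all add: qcomm_1 qcomm_mult_right grading_qcomm_letter)

lemma word_J:
  assumes "x \<in> J"
  shows "word us * x * word vs \<in> L"
  using J_right[OF left_idealD(3)[OF J_left_ideal assms]] J_subset_L by blast

lemma torus_scalar: "torus_letter g \<Longrightarrow> \<exists>c. fgen g - fconst c \<in> L"
proof (clarsimp simp: torus_letter_def)
  fix i assume i: "i \<in> odds n" and g: "g = S i (Suc i) \<or> g = Sinv i"
  have "fsinv i * fs i (i + 1) - 1 \<in> L" using Sinv_inverse[OF i] J_subset_L by blast
  moreover have "fsinv i * (fs i (i + 1) - fconst (lam i)) \<in> L" using L_torus[OF i] by (rule L_closed)
  ultimately have "inverse (lam i) *\<^sub>F ((fsinv i * fs i (i + 1) - 1) - fsinv i * (fs i (i + 1) - fconst (lam i))) \<in> L" (is "?e \<in> _")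
    by (simp only: L_closed)
  also have "?e = fsinv i - fconst (inverse (lam i))"
    using lam_nz[OF i] by (simp add: algebra_simps fconst_eq fscale_algebra)
  finally show "\<exists>c. fgen g - fconst c \<in> L"
    using g L_torus[OF i] by auto
qed

lemma det_scalar:
  assumes "i \<in> odds n"
  shows "\<exists>c. fs (i + 1) i - fconst c \<in> L"
proof -
  \<comment> \<open>On \<xi> relation (3) loses its first term, as s_{ii} kills \<xi>, and s_{i,i+1}
    becomes \<open>lam i\<close>; what remains is -q^2 lam_i s_{i+1,i} = q^3.\<close>
  let ?c = "- (q ^ 3 / (q ^ 2 * lam i))"
  have i: "i \<in> {1..i}" using assms by (auto simp: odds_def elim: oddE)
  have "fs (i+1) (i+1) * fs i i - fconst (q^2) * fs (i+1) i * fs i (i+1) - fconst (q^3) \<in> rels_det n q"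
    using assms by (auto simp: rels_det_def)
  then have "fs (i+1) (i+1) * fs i i - fconst (q^2) * fs (i+1) i * fs i (i+1) - fconst (q^3) \<in> L" (is "?d \<in> L")
    using J_rels J_subset_L by blast
  moreover have "fs (i+1) (i+1) * fs i i \<in> L" using L_raising[OF assms i] by (rule L_closed)
  moreover have "q^2 *\<^sub>F (fs (i+1) i * (fs i (i+1) - fconst (lam i))) \<in> L"
    using L_torus[OF assms] by (simp only: L_closed)
  ultimately have "inverse (q^2 * lam i) *\<^sub>F (fs (i+1) (i+1) * fs i i - ?d
      - q^2 *\<^sub>F (fs (i+1) i * (fs i (i+1) - fconst (lam i)))) \<in> L" (is "?e \<in> _")
    by (simp only: L_closed)
  also have "?e = fs (i + 1) i - fconst ?c"
    using lam_nz[OF assms] q_nz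
    by (simp add: algebra_simps fconst_eq fscale_algebra)
      (simp add: field_simps flip: fscale_left_distrib)
  finally show ?thesis by blast
qed

lemma triangular_scalar_at_end:
  assumes "fgen g - fconst c \<in> L" "triangular (word ws)"
  shows "triangular (word (ws @ [g]))"
proof -
  have "word ws * (fgen g - fconst c) \<in> L" using assms(1) by (rule L_closed)
  also have "word ws * (fgen g - fconst c) = word (ws @ [g]) - c *\<^sub>F word ws"
    by (simp add: algebra_simps fconst_eq)
  finally show ?thesis using assms(2) triangular_cong triangular_fscale by blast
qed

lemma qcomm_word:
  assumes "\<And>h. \<exists>e. qcomm e x (fgen h)"
  shows "\<exists>e. qcomm e x (word ws)"
proof (induction ws)
  case Nil
  show ?case using qcomm_1 by auto
next
  case (Cons h ws)
  then show ?case using qcomm_mult_right assms[of h] unfolding word_simps by blast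
qed

text \<open>A torus letter q-commutes to the right end of the word, where it acts on \<xi> by a
  scalar.\<close>

lemma triangular_torus:
  assumes "torus_letter g" "triangular (word (us @ vs))"
  shows "triangular (word (us @ g # vs))"
proof -
  obtain e where e: "qcomm e (fgen g) (word vs)"
    using qcomm_word[OF torus_letter_qcomm[OF assms(1)]] by blast
  obtain c where c: "fgen g - fconst c \<in> L" using torus_scalar[OF assms(1)] by blast
  have "word us * (fgen g * word vs - q powi e *\<^sub>F (word vs * fgen g)) * word [] \<in> L"
    using e unfolding qcomm_def by (rule word_J)
  also have "word us * (fgen g * word vs - q powi e *\<^sub>F (word vs * fgen g)) * word []
      = word (us @ g # vs) - q powi e *\<^sub>F word ((us @ vs) @ [g])"
    by (simp add: algebra_simps)
  finally show ?thesis
    using triangular_cong triangular_fscale triangular_scalar_at_end[OF c assms(2)] by blast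
qed

text \<open>Solve relation (4) for s_{ia} s_{jb}: its coefficient is a power of q, hence invertible,
  and every other product with nonzero coefficient gives a smaller word.\<close>

lemma triangular_inversion:
  assumes "i \<in> {1..2*n}" "a \<in> {1..2*n}" "j \<in> {1..2*n}" "b \<in> {1..2*n}" "odd i" "even j"
    and smaller: "\<And>ws'. (ws', us @ S i a # S j b # vs) \<in> word_order \<Longrightarrow> triangular (word ws')"
  shows "triangular (word (us @ S i a # S j b # vs))"
proof -
  define W where "W x y = word (us @ x # y # vs)" for x y
  have W: "word us * (fgen x * fgen y) * word vs = W x y" for x y
    by (simp add: W_def mult.assoc)
  \<comment> \<open>Smallness is asked only when the coefficient is nonzero, which turns the deltas
    of relation (4) into usable inequalities.\<close>
  have coeff: "triangular (c *\<^sub>F W x y)"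
    if "c \<noteq> 0 \<Longrightarrow> (us @ x # y # vs, us @ S i a # S j b # vs) \<in> word_order" for c x y
  proof (cases "c = 0")
    case False
    then show ?thesis using triangular_fscale[OF smaller[OF that]] by (simp only: W_def simp_thms)
  qed (simp add: triangular_L L_closed)
  have swap: "(us @ S j x # S i y # vs, us @ S i a # S j b # vs) \<in> word_order" for x y
    using assms by (intro word_order_intros(3)) auto
  have less: "(us @ S k x # S l y # vs, us @ S i a # S j b # vs) \<in> word_order"
    if "k + l < i + j" for k l x y
    using that by (intro word_order_intros(2)) auto
  define \<alpha> where "\<alpha> = q ^ (of_bool (a = j) + of_bool (i = j))"
  define z where "z = q ^ (of_bool (a = b) + of_bool (i = b)) *\<^sub>F W (S j b) (S i a)
      + ((q - inverse q) * q ^ of_bool (a = i) * (of_bool (b < a) - of_bool (i < j)))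
          *\<^sub>F W (S j a) (S i b)
      + ((q - inverse q) * (q ^ of_bool (a = b) * of_bool (b < i))) *\<^sub>F W (S j i) (S b a)
      - ((q - inverse q) * (q ^ of_bool (i = j) * of_bool (a < j))) *\<^sub>F W (S i j) (S a b)
      + ((q - inverse q)^2 * (of_bool (b < a \<and> a < i) - of_bool (a < i \<and> i < j)))
          *\<^sub>F W (S j i) (S a b)"
  have "triangular z"
    unfolding z_def
    by (intro triangular_add triangular_diff coeff)
      (rule swap | (rule less, fastforce simp: of_bool_def split: if_splits))+
  \<comment> \<open>The identity is proved for arbitrary scalars and letters; the coefficients of
    relation (4) are then only matched against it.\<close>
  moreover have "word us * (c1 *\<^sub>F (fgen x1 * fgen y1) - c2 *\<^sub>F (fgen x2 * fgen y2)
        - c3 *\<^sub>F (fgen x3 * fgen y3) - c4 *\<^sub>F (fgen x4 * fgen y4) + c5 *\<^sub>F (fgen x5 * fgen y5)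
        - c6 *\<^sub>F (fgen x6 * fgen y6)) * word vs
      = c1 *\<^sub>F W x1 y1 - (c2 *\<^sub>F W x2 y2 + c3 *\<^sub>F W x3 y3 + c4 *\<^sub>F W x4 y4
        - c5 *\<^sub>F W x5 y5 + c6 *\<^sub>F W x6 y6)"
    for c1 c2 c3 c4 c5 c6 x1 x2 x3 x4 x5 x6 y1 y2 y3 y4 y5 y6
    unfolding W[symmetric] by (simp add: algebra_simps)
  then have "\<alpha> *\<^sub>F W (S i a) (S j b) - z \<in> L"
    using word_J[OF refl_relation[OF assms(1-4)], of us vs] by (simp only: z_def \<alpha>_def)
  ultimately have "triangular (inverse \<alpha> *\<^sub>F (\<alpha> *\<^sub>F W (S i a) (S j b)))"
    using triangular_cong triangular_fscale by blast
  then show ?thesis using q_nz by (simp add: \<alpha>_def W_def)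
qed

lemma generator_cases:
  obtains (zero) "fgen g \<in> J" | (torus) "torus_letter g"
  | (raising) i a where "g = S i a" "i \<in> odds n" "a \<in> {1..i}"
  | (lowering) i a where "g = S i a" "i \<in> {1..2*n}" "even i" "a \<in> {1..i}"
proof (cases "g \<in> sp_gens n")
  case True
  then consider i a where "g = S i a" "i \<in> {1..2*n}" "a \<in> {1..2*n}" | i where "g = Sinv i" "i \<in> odds n"
    by (auto simp: sp_gens_def)
  then show ?thesis
  proof cases
    case 1
    then have odds: "i \<in> odds n" if "odd i"
      using that by (cases "i = 2 * n") (auto simp: odds_def)
    show ?thesis
    proof (cases "a \<le> i")
      case True
      then show ?thesis using 1 odds that(3,4) by (cases "even i") auto
    next
      case False
      then show ?thesis
        using 1 that(1,2) s_zero[of i a] odds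
        by (cases "odd i \<and> a = i + 1") (auto simp: torus_letter_def)
    qed
  next
    case 2
    then show ?thesis using that(2) by (auto simp: torus_letter_def)
  qed
qed (use that(1) J_gens in auto)

lemma lowering_height:
  assumes "even i" "a \<in> {1..i}"
  shows "letter_height (S i a) \<le> 0" "a \<noteq> i - 1 \<Longrightarrow> letter_height (S i a) < 0"
proof -
  show "letter_height (S i a) \<le> 0"
    using assms by (auto simp: height_def elim!: evenE oddE)
  assume "a \<noteq> i - 1"
  then have "a + 1 < i" if "odd a"
    using assms that by (cases "a = i") auto
  then show "letter_height (S i a) < 0"
    using assms by (auto simp: height_def elim!: evenE oddE)
qed

text \<open>Deletion and rewriting leave two kinds of words: those ending in an odd row, which kill
  \<xi>, and those with all rows even. In the latter the last letter decides: s_{i,i-1} acts by a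
  scalar, and any other makes the total weight negative, since no letter before it has positive
  weight.\<close>

lemma triangular_word: "triangular (word ws)"
proof (induction ws rule: wf_induct_rule[OF wf_word_order])
  case (1 ws)
  show ?case
  proof (cases "\<exists>g\<in>set ws. fgen g \<in> J \<or> torus_letter g")
    case True
    then obtain g us vs where g: "ws = us @ g # vs" "fgen g \<in> J \<or> torus_letter g"
      by (meson split_list)
    have "triangular (word (us @ vs))"
      using 1 word_order_intros(1)[of "us @ vs" ws] by (simp add: g(1) del: word_simps)
    then show ?thesis
      using g triangular_torus triangular_L[OF word_J, of "fgen g" us vs] by (auto simp: mult.assoc)
  next
    case False
    then have gens: "(\<exists>i a. g = S i a \<and> i \<in> odds n \<and> a \<in> {1..i})
        \<or> (\<exists>i a. g = S i a \<and> i \<in> {1..2*n} \<and> even i \<and> a \<in> {1..i})" if "g \<in> set ws" for g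
      using that by (cases g rule: generator_cases) blast+
    show ?thesis
    proof (cases ws rule: row_pattern_cases)
      case (last us x)
      then have "fgen x \<in> L" using gens[of x] L_raising by auto
      then show ?thesis by (simp add: last triangular_L L_closed)
    next
      case (inversion us x y vs)
      obtain i a where x: "x = S i a" "i \<in> odds n" "a \<in> {1..i}"
        using gens[of x] inversion by auto
      obtain j b where y: "y = S j b" "j \<in> {1..2*n}" "even j" "b \<in> {1..j}"
        using gens[of y] inversion by (auto simp: odds_def)
      show ?thesis
        unfolding inversion(1) x(1) y(1)
        using 1 x y inversion by (intro triangular_inversion) (auto simp: odds_def)
    next
      case even
      then have low: "\<exists>i a. g = S i a \<and> i \<in> {1..2*n} \<and> even i \<and> a \<in> {1..i}" if "g \<in> set ws" for g
        using gens[OF that] that by (force simp: odds_def)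
      show ?thesis
      proof (cases ws rule: rev_cases)
        case Nil
        then show ?thesis by (simp add: triangular_1)
      next
        case (snoc us g)
        then obtain i a where g: "g = S i a" "i \<in> {1..2*n}" "even i" "a \<in> {1..i}"
          using low[of g] by auto
        show ?thesis
        proof (cases "a = i - 1")
          case True
          have "i - 1 \<in> odds n" "i = i - 1 + 1" using g by (auto simp: odds_def elim!: evenE)
          then obtain c where "fgen g - fconst c \<in> L"
            using det_scalar[of "i - 1"] True g(1) by metis
          moreover have "triangular (word us)" using 1 snoc by (simp add: word_order_intros(1))
          ultimately show ?thesis unfolding snoc by (rule triangular_scalar_at_end)
        next
          case False
          have "sum_list (map letter_height us) \<le> 0"
            using low lowering_height(1) snoc by (intro sum_list_nonpos) fastforce
          moreover have "letter_height g < 0" using lowering_height(2) g False by simp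
          ultimately have "sum_list (map letter_height ws) \<noteq> 0" by (simp add: snoc)
          then show ?thesis using triangular_lower_weight[OF grading_qcomm_word] by blast
        qed
      qed
    qed
  qed
qed

theorem triangular: "triangular x"
  by (rule free_alg_word_induct)
    (simp_all add: triangular_add triangular_fscale triangular_word)

end

section \<open>From triangularity to the uniqueness of the maximal submodule\<close>

context highest_weight_ideal
begin

text \<open>In the application \<open>N\<close> describes a submodule of M(lambda),
  \<open>L'\<close> is the annihilator of the image v of \<xi> in V, w \<xi> lies in the submodule
  and w v = v. Up to terms killed by p(K), w acts on \<xi> as a scalar c. Comparison in V forces c =
  1, so p(K) w \<xi> is a nonzero multiple of \<xi> inside the submodule.\<close>

lemma top_vector_mem:
  assumes N: "left_ideal N" "L \<subseteq> N" and L': "left_ideal L'" "L \<subseteq> L'" "1 \<notin> L'"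
    and w: "w \<in> N" "w - 1 \<in> L'"
  shows "1 \<in> N"
proof -
  obtain c p where p: "poly p top_weight \<noteq> 0" "ev grading p * (w - fconst c) \<in> L"
    using triangular[of w] by (auto simp: triangular_def)
  let ?P = "ev grading p"
  have eigen: "?P - poly p top_weight *\<^sub>F 1 \<in> L"
    using left_ideal_ev_eigen[OF L_left_ideal, of grading top_weight 1 p] top_weight by simp
  \<comment> \<open>Modulo \<open>L\<close>, p(K) is the nonzero scalar
    \<open>poly p top_weight\<close>.\<close>
  have one_mem: "1 \<in> I" if "left_ideal I" "L \<subseteq> I" "?P \<in> I" for I
    using left_ideal_diff_cancel[OF that(1)] left_ideal_fscale_cancel[OF that(1) _ p(1)] eigen that
    by blast
  have "?P * (w - fconst c) - ?P * (w - 1) \<in> L'"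
    using p(2) L' w(2) by (auto intro: left_ideal_diff left_idealD(3))
  also have "?P * (w - fconst c) - ?P * (w - 1) = (1 - c) *\<^sub>F ?P"
    by (simp add: algebra_simps fconst_eq fscale_algebra)
  \<comment> \<open>Otherwise \<open>L'\<close> would contain p(K) and hence 1.\<close>
  finally have "c = 1"
    using left_ideal_fscale_cancel[OF L'(1)] one_mem[OF L'(1,2)] L'(3) by fastforce
  then have "?P * w - ?P \<in> N" using p(2) N(2) by (auto simp: algebra_simps)
  moreover have "?P * w \<in> N" using N(1) w(1) by (rule left_idealD(3))
  ultimately have "?P * w - (?P * w - ?P) \<in> N" using left_ideal_diff[OF N(1)] by blast
  then have "?P \<in> N" by (simp only: diff_diff_eq2 add_diff_cancel_left')
  then show ?thesis by (rule one_mem[OF N])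
qed

end

section \<open>Quotients of left modules\<close>

definition left_module_hom ::
    "('a, 'c) ring_scheme \<Rightarrow> ('a, 'b) module \<Rightarrow> ('a, 'd) module \<Rightarrow> ('b \<Rightarrow> 'd) \<Rightarrow> bool" where
  "left_module_hom R M M' f \<longleftrightarrow>
     f ` carrier M \<subseteq> carrier M' \<and>
     (\<forall>x\<in>carrier M. \<forall>y\<in>carrier M. f (x \<oplus>\<^bsub>M\<^esub> y) = f x \<oplus>\<^bsub>M'\<^esub> f y) \<and>
     (\<forall>a\<in>carrier R. \<forall>x\<in>carrier M. f (a \<odot>\<^bsub>M\<^esub> x) = a \<odot>\<^bsub>M'\<^esub> f x)"

lemma left_module_homD:
  assumes "left_module_hom R M M' f"
  shows "x \<in> carrier M \<Longrightarrow> f x \<in> carrier M'"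
    "x \<in> carrier M \<Longrightarrow> y \<in> carrier M \<Longrightarrow> f (x \<oplus>\<^bsub>M\<^esub> y) = f x \<oplus>\<^bsub>M'\<^esub> f y"
    "a \<in> carrier R \<Longrightarrow> x \<in> carrier M \<Longrightarrow> f (a \<odot>\<^bsub>M\<^esub> x) = a \<odot>\<^bsub>M'\<^esub> f x"
  using assms by (auto simp: left_module_hom_def)

context left_module
begin

lemma smult_zero_left [simp]: "x \<in> carrier M \<Longrightarrow> \<zero>\<^bsub>R\<^esub> \<odot>\<^bsub>M\<^esub> x = \<zero>\<^bsub>M\<^esub>"
proof -
  assume x: "x \<in> carrier M"
  have "\<zero>\<^bsub>R\<^esub> \<odot>\<^bsub>M\<^esub> x \<oplus>\<^bsub>M\<^esub> \<zero>\<^bsub>R\<^esub> \<odot>\<^bsub>M\<^esub> x = \<zero>\<^bsub>R\<^esub> \<odot>\<^bsub>M\<^esub> x"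
    using x by (simp flip: smult_l_distr)
  with x show ?thesis by (metis M.add.l_cancel_one' R.zero_closed smult_closed)
qed

lemma smult_zero_right [simp]: "a \<in> carrier R \<Longrightarrow> a \<odot>\<^bsub>M\<^esub> \<zero>\<^bsub>M\<^esub> = \<zero>\<^bsub>M\<^esub>"
  by (metis M.add.l_cancel_one' M.zero_closed M.l_zero smult_closed smult_r_distr)

lemma smult_minus_one: "x \<in> carrier M \<Longrightarrow> (\<ominus>\<^bsub>R\<^esub> \<one>\<^bsub>R\<^esub>) \<odot>\<^bsub>M\<^esub> x = \<ominus>\<^bsub>M\<^esub> x"
proof -
  assume x: "x \<in> carrier M"
  have "(\<ominus>\<^bsub>R\<^esub> \<one>\<^bsub>R\<^esub>) \<odot>\<^bsub>M\<^esub> x \<oplus>\<^bsub>M\<^esub> x = (\<ominus>\<^bsub>R\<^esub> \<one>\<^bsub>R\<^esub> \<oplus>\<^bsub>R\<^esub> \<one>\<^bsub>R\<^esub>) \<odot>\<^bsub>M\<^esub> x"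
    using x by (simp add: smult_l_distr)
  also have "\<dots> = \<zero>\<^bsub>M\<^esub>" using x by (simp add: R.l_neg)
  finally show ?thesis using x by (simp add: M.minus_equality)
qed

lemma submoduleI':
  assumes "H \<subseteq> carrier M" "\<zero>\<^bsub>M\<^esub> \<in> H" "\<And>x y. x \<in> H \<Longrightarrow> y \<in> H \<Longrightarrow> x \<oplus>\<^bsub>M\<^esub> y \<in> H"
    "\<And>a x. a \<in> carrier R \<Longrightarrow> x \<in> H \<Longrightarrow> a \<odot>\<^bsub>M\<^esub> x \<in> H"
  shows "submodule H R M"
proof (intro submodule.intro subgroup.intro)
  fix x assume x: "x \<in> H"
  then have "\<ominus>\<^bsub>M\<^esub> x \<in> H" using assms(1) assms(4)[of "\<ominus>\<^bsub>R\<^esub> \<one>\<^bsub>R\<^esub>" x] smult_minus_one by auto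
  then show "inv\<^bsub>add_monoid M\<^esub> x \<in> H" by (simp add: a_inv_def)
qed (use assms in \<open>auto simp: submodule_axioms_def\<close>)

lemma submoduleD:
  assumes "submodule H R M"
  shows "H \<subseteq> carrier M" "\<zero>\<^bsub>M\<^esub> \<in> H" "x \<in> H \<Longrightarrow> y \<in> H \<Longrightarrow> x \<oplus>\<^bsub>M\<^esub> y \<in> H"
    "a \<in> carrier R \<Longrightarrow> x \<in> H \<Longrightarrow> a \<odot>\<^bsub>M\<^esub> x \<in> H" "abelian_subgroup H M"
proof -
  interpret submodule H R M by fact
  show "H \<subseteq> carrier M" "\<zero>\<^bsub>M\<^esub> \<in> H" "x \<in> H \<Longrightarrow> y \<in> H \<Longrightarrow> x \<oplus>\<^bsub>M\<^esub> y \<in> H"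
    "a \<in> carrier R \<Longrightarrow> x \<in> H \<Longrightarrow> a \<odot>\<^bsub>M\<^esub> x \<in> H"
    using subset one_closed m_closed smult_closed by auto
  show "abelian_subgroup H M"
    by (intro abelian_subgroupI3 additive_subgroupI M.abelian_group_axioms) unfold_locales
qed

end

locale left_module_quotient = left_module R M
  for R :: "('a, 'c) ring_scheme" (structure) and M :: "('a, 'b) module" (structure) +
  fixes N assumes submodule: "submodule N R M"
begin

sublocale N: abelian_subgroup N M using submoduleD(5)[OF submodule] .

lemma coset_eq_iff:
  assumes x: "x \<in> carrier M" and y: "y \<in> carrier M"
  shows "N +>\<^bsub>M\<^esub> x = N +>\<^bsub>M\<^esub> y \<longleftrightarrow> x \<ominus>\<^bsub>M\<^esub> y \<in> N"
proof -
  have "N +>\<^bsub>M\<^esub> x = N +>\<^bsub>M\<^esub> y \<longleftrightarrow> x \<in> N +>\<^bsub>M\<^esub> y"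
    using N.a_rcos_self[OF x] N.a_repr_independence'[OF _ y, of x] by auto
  then show ?thesis using N.a_rcos_module[OF y x] by (simp add: M.minus_eq)
qed

lemma quotient_simps:
  shows "carrier (quotient_module M N) = (\<lambda>x. N +>\<^bsub>M\<^esub> x) ` carrier M"
    "\<zero>\<^bsub>quotient_module M N\<^esub> = N"
    "x \<in> carrier M \<Longrightarrow> y \<in> carrier M \<Longrightarrow>
      (N +>\<^bsub>M\<^esub> x) \<oplus>\<^bsub>quotient_module M N\<^esub> (N +>\<^bsub>M\<^esub> y) = N +>\<^bsub>M\<^esub> (x \<oplus>\<^bsub>M\<^esub> y)"
    "a \<in> carrier R \<Longrightarrow> x \<in> carrier M \<Longrightarrow>
      a \<odot>\<^bsub>quotient_module M N\<^esub> (N +>\<^bsub>M\<^esub> x) = N +>\<^bsub>M\<^esub> (a \<odot>\<^bsub>M\<^esub> x)"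
proof -
  show "carrier (quotient_module M N) = (\<lambda>x. N +>\<^bsub>M\<^esub> x) ` carrier M"
    by (auto simp: quotient_module_def A_RCOSETS_def')
  show "\<zero>\<^bsub>quotient_module M N\<^esub> = N" by (simp add: quotient_module_def)
  show "(N +>\<^bsub>M\<^esub> x) \<oplus>\<^bsub>quotient_module M N\<^esub> (N +>\<^bsub>M\<^esub> y) = N +>\<^bsub>M\<^esub> (x \<oplus>\<^bsub>M\<^esub> y)"
    if "x \<in> carrier M" "y \<in> carrier M"
    using that by (simp add: quotient_module_def N.a_rcos_sum)
  show "a \<odot>\<^bsub>quotient_module M N\<^esub> (N +>\<^bsub>M\<^esub> x) = N +>\<^bsub>M\<^esub> (a \<odot>\<^bsub>M\<^esub> x)"
    if a: "a \<in> carrier R" and x: "x \<in> carrier M"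
  proof -
    \<comment> \<open>The action on a coset is a union over its representatives, which all
      contribute the same coset.\<close>
    have "N +>\<^bsub>M\<^esub> (a \<odot>\<^bsub>M\<^esub> y) = N +>\<^bsub>M\<^esub> (a \<odot>\<^bsub>M\<^esub> x)" if "y \<in> N +>\<^bsub>M\<^esub> x" for y
    proof -
      obtain h where h: "h \<in> N" "y = h \<oplus>\<^bsub>M\<^esub> x"
        using \<open>y \<in> _\<close> by (auto simp: a_r_coset_def')
      have hc: "h \<in> carrier M" using h(1) by simp
      have "a \<odot>\<^bsub>M\<^esub> y \<ominus>\<^bsub>M\<^esub> a \<odot>\<^bsub>M\<^esub> x = a \<odot>\<^bsub>M\<^esub> h"
        using a x hc by (simp add: h(2) smult_r_distr M.minus_eq M.r_neg M.a_assoc)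
      also have "\<dots> \<in> N" using submoduleD(4)[OF submodule a h(1)] .
      finally show ?thesis using a x hc h(2) by (subst coset_eq_iff) auto
    qed
    moreover have "N +>\<^bsub>M\<^esub> x \<noteq> {}" using N.a_rcos_self[OF x] by blast
    ultimately have "(\<Union>y\<in>N +>\<^bsub>M\<^esub> x. N +>\<^bsub>M\<^esub> (a \<odot>\<^bsub>M\<^esub> y)) = N +>\<^bsub>M\<^esub> (a \<odot>\<^bsub>M\<^esub> x)"
      by (rule SUP_eq_const[rotated])
    then show ?thesis by (simp only: quotient_module_def module.simps)
  qed
qed

lemma coset_eq_zero_iff:
  assumes "x \<in> carrier M"
  shows "N +>\<^bsub>M\<^esub> x = N \<longleftrightarrow> x \<in> N"
  using coset_eq_iff[OF assms M.zero_closed] M.a_coset_add_zero[OF submoduleD(1)[OF submodule]]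
    M.minus_equality[of "\<zero>\<^bsub>M\<^esub>" "\<zero>\<^bsub>M\<^esub>"] assms
  by (simp add: M.minus_eq)

sublocale quotient: left_module R "quotient_module M N"
proof -
  have zero: "N = N +>\<^bsub>M\<^esub> \<zero>\<^bsub>M\<^esub>" using coset_eq_zero_iff[of "\<zero>\<^bsub>M\<^esub>"] by simp
  have "abelian_group (quotient_module M N)"
  proof (rule abelian_groupI)
    fix C assume "C \<in> carrier (quotient_module M N)"
    then obtain x where x: "x \<in> carrier M" "C = N +>\<^bsub>M\<^esub> x" by (auto simp: quotient_simps)
    then have "(N +>\<^bsub>M\<^esub> \<ominus>\<^bsub>M\<^esub> x) \<oplus>\<^bsub>quotient_module M N\<^esub> C = N +>\<^bsub>M\<^esub> \<zero>\<^bsub>M\<^esub>"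
      by (simp add: quotient_simps M.l_neg)
    then show "\<exists>D\<in>carrier (quotient_module M N).
        D \<oplus>\<^bsub>quotient_module M N\<^esub> C = \<zero>\<^bsub>quotient_module M N\<^esub>"
      using x(1) zero by (auto simp: quotient_simps)
    have "(N +>\<^bsub>M\<^esub> \<zero>\<^bsub>M\<^esub>) \<oplus>\<^bsub>quotient_module M N\<^esub> C = C"
      using x by (simp add: quotient_simps)
    then show "\<zero>\<^bsub>quotient_module M N\<^esub> \<oplus>\<^bsub>quotient_module M N\<^esub> C = C"
      using zero by (simp add: quotient_simps)
  next
    show "\<zero>\<^bsub>quotient_module M N\<^esub> \<in> carrier (quotient_module M N)"
      using zero by (auto simp: quotient_simps)
  qed (auto simp: quotient_simps M.a_ac)
  then show "left_module R (quotient_module M N)"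
    by (intro left_module.intro left_module_axioms.intro R.ring_axioms)
      (auto simp: quotient_simps smult_l_distr smult_r_distr smult_assoc)
qed

end

locale left_module_epi =
  M: left_module R M + V: left_module R V
  for R :: "('a, 'c) ring_scheme" and M :: "('a, 'b) module" and V :: "('a, 'd) module" +
  fixes \<phi> assumes hom: "left_module_hom R M V \<phi>" and surj: "\<phi> ` carrier M = carrier V"
begin

definition kernel_submodule :: "'b set" where
  "kernel_submodule = {x\<in>carrier M. \<phi> x = \<zero>\<^bsub>V\<^esub>}"

lemma hom_zero: "\<phi> \<zero>\<^bsub>M\<^esub> = \<zero>\<^bsub>V\<^esub>"
  using left_module_homD(3)[OF hom, of "\<zero>\<^bsub>R\<^esub>" "\<zero>\<^bsub>M\<^esub>"] left_module_homD(1)[OF hom, of "\<zero>\<^bsub>M\<^esub>"] by simp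

lemma hom_minus: "x \<in> carrier M \<Longrightarrow> y \<in> carrier M \<Longrightarrow> \<phi> (x \<ominus>\<^bsub>M\<^esub> y) = \<phi> x \<ominus>\<^bsub>V\<^esub> \<phi> y"
  using left_module_homD[OF hom]
  by (simp add: M.M.minus_eq V.M.minus_eq flip: M.smult_minus_one V.smult_minus_one)

lemma kernel_submodule: "submodule kernel_submodule R M"
  by (rule M.submoduleI') (auto simp: kernel_submodule_def hom_zero left_module_homD[OF hom])

sublocale kernel: left_module_quotient R M kernel_submodule
  by (intro left_module_quotient.intro left_module_quotient_axioms.intro
      M.left_module_axioms kernel_submodule)

lemma hom_eq_iff:
  assumes "x \<in> carrier M" "y \<in> carrier M"
  shows "kernel_submodule +>\<^bsub>M\<^esub> x = kernel_submodule +>\<^bsub>M\<^esub> y \<longleftrightarrow> \<phi> x = \<phi> y"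
proof -
  have "\<phi> x \<ominus>\<^bsub>V\<^esub> \<phi> y = \<zero>\<^bsub>V\<^esub> \<longleftrightarrow> \<phi> x = \<phi> y"
  proof
    assume "\<phi> x \<ominus>\<^bsub>V\<^esub> \<phi> y = \<zero>\<^bsub>V\<^esub>"
    then have "(\<phi> x \<ominus>\<^bsub>V\<^esub> \<phi> y) \<oplus>\<^bsub>V\<^esub> \<phi> y = \<phi> y"
      using left_module_homD(1)[OF hom] assms by simp
    then show "\<phi> x = \<phi> y"
      using left_module_homD(1)[OF hom] assms by (simp add: V.M.minus_eq V.M.a_assoc V.M.l_neg)
  qed (use left_module_homD(1)[OF hom] assms in \<open>simp add: V.M.minus_eq V.M.r_neg\<close>)
  then have "x \<ominus>\<^bsub>M\<^esub> y \<in> kernel_submodule \<longleftrightarrow> \<phi> x = \<phi> y"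
    unfolding kernel_submodule_def mem_Collect_eq hom_minus[OF assms]
    using M.M.minus_closed[OF assms] by blast
  then show ?thesis by (simp only: kernel.coset_eq_iff[OF assms])
qed

text \<open>First isomorphism theorem, read from \<open>V\<close> to the quotient through chosen
  preimages.\<close>

lemma isomorphic_quotient: "isomorphic_modules R V (quotient_module M kernel_submodule)"
proof -
  let ?f = "\<lambda>v. kernel_submodule +>\<^bsub>M\<^esub> inv_into (carrier M) \<phi> v"
  have f: "?f (\<phi> x) = kernel_submodule +>\<^bsub>M\<^esub> x" if "x \<in> carrier M" for x
    using that hom_eq_iff[of "inv_into (carrier M) \<phi> (\<phi> x)" x]
    by (simp add: inv_into_into f_inv_into_f)
  note quot = kernel.quotient_simps
  have bij: "bij_betw ?f (carrier V) (carrier (quotient_module M kernel_submodule))"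
    unfolding bij_betw_def inj_on_def surj[symmetric] quot
    by (auto simp: f hom_eq_iff image_image)
  have "?f (v \<oplus>\<^bsub>V\<^esub> w) = ?f v \<oplus>\<^bsub>quotient_module M kernel_submodule\<^esub> ?f w"
    if vw: "v \<in> carrier V" "w \<in> carrier V" for v w
  proof -
    obtain x y where "x \<in> carrier M" "y \<in> carrier M" "v = \<phi> x" "w = \<phi> y"
      using vw surj by blast
    then show ?thesis using f[of "x \<oplus>\<^bsub>M\<^esub> y"] by (simp add: f quot left_module_homD[OF hom])
  qed
  moreover have "?f (a \<odot>\<^bsub>V\<^esub> v) = a \<odot>\<^bsub>quotient_module M kernel_submodule\<^esub> ?f v"
    if av: "a \<in> carrier R" "v \<in> carrier V" for a v
  proof -
    obtain x where "x \<in> carrier M" "v = \<phi> x" using av surj by blast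
    then show ?thesis using f[of "a \<odot>\<^bsub>M\<^esub> x"] av(1) by (simp add: f quot left_module_homD[OF hom])
  qed
  ultimately show ?thesis unfolding isomorphic_modules_def using bij by blast
qed

text \<open>\<open>verma\<close> is a quotient of the regular module, so this turns the action on a
  vector of V into a map from M(lambda) to V.\<close>

lemma factor:
  assumes I: "submodule I R M" "I \<subseteq> kernel_submodule"
  obtains \<psi> where "left_module_epi R (quotient_module M I) V \<psi>"
    "\<And>x. x \<in> carrier M \<Longrightarrow> \<psi> (I +>\<^bsub>M\<^esub> x) = \<phi> x"
proof -
  interpret I: left_module_quotient R M I
    by (intro left_module_quotient.intro left_module_quotient_axioms.intro M.left_module_axioms I(1))
  note quot = I.quotient_simps
  \<comment> \<open>The chosen representative does not matter, since \<open>I\<close> lies in the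
    kernel.\<close>
  define \<psi> where "\<psi> C = \<phi> (SOME x. x \<in> C)" for C
  have \<psi>: "\<psi> (I +>\<^bsub>M\<^esub> x) = \<phi> x" if x: "x \<in> carrier M" for x
  proof -
    define y where "y = (SOME y. y \<in> I +>\<^bsub>M\<^esub> x)"
    have "y \<in> I +>\<^bsub>M\<^esub> x"
      unfolding y_def using I.N.a_rcos_self[OF x] by (rule someI)
    then obtain h where h: "h \<in> I" "y = h \<oplus>\<^bsub>M\<^esub> x"
      unfolding a_r_coset_def' by blast
    have "h \<in> carrier M" "\<phi> h = \<zero>\<^bsub>V\<^esub>"
      using h(1) I(2) unfolding kernel_submodule_def by blast+
    with h(2) x show ?thesis by (simp add: \<psi>_def left_module_homD[OF hom] flip: y_def)
  qed
  have "left_module_epi R (quotient_module M I) V \<psi>"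
  proof unfold_locales
    show "left_module_hom R (quotient_module M I) V \<psi>"
      by (auto simp: left_module_hom_def quot \<psi> left_module_homD[OF hom])
    show "\<psi> ` carrier (quotient_module M I) = carrier V"
      by (simp add: quot image_image \<psi> flip: surj cong: image_cong)
  qed
  with \<psi> that show thesis by blast
qed

end

lemma regular_left_module:
  assumes "ring R"
  shows "left_module R (regular_module R)"
proof -
  interpret ring R by fact
  have "abelian_group (regular_module R)"
  proof (rule abelian_groupI)
    fix x assume "x \<in> carrier (regular_module R)"
    then show "\<exists>y\<in>carrier (regular_module R).
        y \<oplus>\<^bsub>regular_module R\<^esub> x = \<zero>\<^bsub>regular_module R\<^esub>"
      by (intro bexI[of _ "\<ominus>\<^bsub>R\<^esub> x"]) (simp_all add: regular_module_def l_neg)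
  qed (simp_all add: regular_module_def a_ac)
  then show ?thesis
    by (intro left_module.intro left_module_axioms.intro ring_axioms)
      (auto simp: regular_module_def l_distr r_distr m_assoc)
qed

lemma left_ideal_gen_submodule:
  assumes "ring R" "A \<subseteq> carrier R"
  shows "submodule (left_ideal_gen R A) R (regular_module R)" "A \<subseteq> left_ideal_gen R A"
proof -
  interpret left_module R "regular_module R" using regular_left_module[OF assms(1)] .
  \<comment> \<open>The whole ring belongs to the intersected family, so the intersection stays
    inside the carrier.\<close>
  have carrier: "submodule (carrier R) R (regular_module R)"
    by (rule submoduleI') (simp_all add: regular_module_def)
  show "submodule (left_ideal_gen R A) R (regular_module R)"
  proof (rule submoduleI')
    show "left_ideal_gen R A \<subseteq> carrier (regular_module R)"
      using carrier assms(2) by (auto simp: left_ideal_gen_def regular_module_def)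
  qed (auto simp: left_ideal_gen_def submoduleD)
  show "A \<subseteq> left_ideal_gen R A" by (auto simp: left_ideal_gen_def)
qed

section \<open>The projection onto the words in given letters\<close>

text \<open>
  Precomposing with this ring endomorphism makes the quotient map onto $U'_q(sp_{2n})$ total on the
  type, so that no carrier conditions are needed in the free algebra.
\<close>

definition restrict_letters :: "'x set \<Rightarrow> 'x free_alg \<Rightarrow> 'x free_alg" where
  "restrict_letters C f =
     (\<Sum>w\<in>{w\<in>Poly_Mapping.keys f. set (letters w) \<subseteq> C}. Poly_Mapping.single w (Poly_Mapping.lookup f w))"

lemma lookup_restrict_letters:
  "Poly_Mapping.lookup (restrict_letters C f) w =
     (if set (letters w) \<subseteq> C then Poly_Mapping.lookup f w else 0)"
  by (auto simp: restrict_letters_def lookup_sum lookup_single when_def in_keys_iff sum.delta'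
      if_distrib cong: if_cong)

lemma restrict_letters_add: "restrict_letters C (f + g) = restrict_letters C f + restrict_letters C g"
  by (rule poly_mapping_eqI) (simp add: lookup_restrict_letters lookup_add)

lemma restrict_letters_0: "restrict_letters C 0 = 0"
  by (rule poly_mapping_eqI) (simp add: lookup_restrict_letters)

lemma restrict_letters_single:
  "restrict_letters C (Poly_Mapping.single w c) =
     (if set (letters w) \<subseteq> C then Poly_Mapping.single w c else 0)"
  by (rule poly_mapping_eqI) (auto simp: lookup_restrict_letters lookup_single when_def)

lemma restrict_letters_sum:
  "restrict_letters C (\<Sum>i\<in>A. f i) = (\<Sum>i\<in>A. restrict_letters C (f i))"
  by (induction A rule: infinite_finite_induct) (simp_all add: restrict_letters_0 restrict_letters_add)

lemma letters_simps [simp]: "letters 0 = []" "letters (u + v) = letters u @ letters v"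
  by (simp_all add: zero_free_monoid_def plus_free_monoid_def)

lemma restrict_letters_mult: "restrict_letters C (f * g) = restrict_letters C f * restrict_letters C g"
proof -
  have single: "restrict_letters C (Poly_Mapping.single u a * Poly_Mapping.single v b)
      = restrict_letters C (Poly_Mapping.single u a) * restrict_letters C (Poly_Mapping.single v b)"
    for u v :: "'a free_monoid" and a b
    by (simp add: mult_single restrict_letters_single)
  have "restrict_letters C ((\<Sum>u\<in>A. Poly_Mapping.single u (x u)) * (\<Sum>v\<in>B. Poly_Mapping.single v (y v)))
     = restrict_letters C (\<Sum>u\<in>A. Poly_Mapping.single u (x u))
       * restrict_letters C (\<Sum>v\<in>B. Poly_Mapping.single v (y v))"
    for A B :: "'a free_monoid set" and x y
    by (simp add: sum_product restrict_letters_sum single)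
  then show ?thesis by (subst (1 2 3 4) poly_mapping_sum_single)
qed

lemma restrict_letters_1: "restrict_letters C 1 = 1"
  using restrict_letters_single[of C 0 1] by simp

lemma restrict_letters_in_carrier: "restrict_letters C f \<in> carrier (free_alg C)"
  by (auto simp: free_alg_def in_keys_iff lookup_restrict_letters split: if_splits)

lemma restrict_letters_ident: "f \<in> carrier (free_alg C) \<Longrightarrow> restrict_letters C f = f"
  by (rule poly_mapping_eqI) (auto simp: free_alg_def in_keys_iff lookup_restrict_letters)

lemma restrict_letters_fgen: "x \<notin> C \<Longrightarrow> restrict_letters C (fgen x) = 0"
  by (simp add: fgen_def restrict_letters_single)

text \<open>As fixed points of a ring endomorphism the carrier inherits its closure properties from
  the homomorphism laws.\<close>

lemma carrier_free_alg_iff: "f \<in> carrier (free_alg C) \<longleftrightarrow> restrict_letters C f = f"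
  using restrict_letters_ident restrict_letters_in_carrier by metis

lemma free_alg_carrier:
  "0 \<in> carrier (free_alg C)" "1 \<in> carrier (free_alg C)" "fconst c \<in> carrier (free_alg C)"
  "x \<in> C \<Longrightarrow> fgen x \<in> carrier (free_alg C)"
  "f \<in> carrier (free_alg C) \<Longrightarrow> g \<in> carrier (free_alg C) \<Longrightarrow> f + g \<in> carrier (free_alg C)"
  "f \<in> carrier (free_alg C) \<Longrightarrow> g \<in> carrier (free_alg C) \<Longrightarrow> f - g \<in> carrier (free_alg C)"
  "f \<in> carrier (free_alg C) \<Longrightarrow> g \<in> carrier (free_alg C) \<Longrightarrow> f * g \<in> carrier (free_alg C)"
proof -
  show "f - g \<in> carrier (free_alg C)" if "f \<in> carrier (free_alg C)" "g \<in> carrier (free_alg C)"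
    using that restrict_letters_add[of C "f - g" g] unfolding carrier_free_alg_iff by (simp add: eq_diff_eq)
  show "fconst c \<in> carrier (free_alg C)"
    unfolding carrier_free_alg_iff by (simp add: fconst_def restrict_letters_single)
qed (simp_all add: carrier_free_alg_iff restrict_letters_0 restrict_letters_1 restrict_letters_add
    restrict_letters_mult fgen_def restrict_letters_single)

lemma free_alg_ops:
  "f \<otimes>\<^bsub>free_alg C\<^esub> g = f * g" "\<one>\<^bsub>free_alg C\<^esub> = 1" "\<zero>\<^bsub>free_alg C\<^esub> = 0"
  "f \<oplus>\<^bsub>free_alg C\<^esub> g = f + g"
  by (simp_all add: free_alg_def)

lemma free_alg_ring: "ring (free_alg C)"
proof (rule ringI)
  show "abelian_group (free_alg C)"
  proof (rule abelian_groupI)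
    fix f assume f: "f \<in> carrier (free_alg C)"
    then have "0 - f \<in> carrier (free_alg C)" by (intro free_alg_carrier)
    then show "\<exists>g\<in>carrier (free_alg C). g \<oplus>\<^bsub>free_alg C\<^esub> f = \<zero>\<^bsub>free_alg C\<^esub>"
      by (rule bexI[rotated]) (simp add: free_alg_ops)
  qed (use free_alg_carrier in \<open>auto simp: free_alg_ops add_ac\<close>)
  show "monoid (free_alg C)"
    by (rule monoidI) (use free_alg_carrier in \<open>auto simp: free_alg_ops mult.assoc\<close>)
qed (simp_all add: free_alg_ops algebra_simps)

section \<open>The quotient map onto the twisted quantized enveloping algebra\<close>

locale sp_algebra =
  fixes n :: nat and q :: complex
begin

abbreviation "A \<equiv> free_alg (sp_gens n)"

abbreviation "U \<equiv> Uq_sp n q"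

lemma rels_carrier:
  "rels_zero n \<union> rels_inv n \<union> rels_det n q \<union> rels_refl n q \<subseteq> carrier A"
proof -
  have s: "fs i j \<in> carrier A" if "i \<in> {1..2*n}" "j \<in> {1..2*n}" for i j
    using that by (intro free_alg_carrier) (auto simp: sp_gens_def)
  have sinv: "fsinv i \<in> carrier A" if "i \<in> odds n" for i
    using that by (intro free_alg_carrier) (auto simp: sp_gens_def)
  have odds: "i \<in> {1..2*n}" "i + 1 \<in> {1..2*n}" if "i \<in> odds n" for i
    using that by (auto simp: odds_def elim: oddE)
  have "rels_zero n \<subseteq> carrier A" using s unfolding rels_zero_def by blast
  moreover have "rels_inv n \<subseteq> carrier A"
    using s sinv odds unfolding rels_inv_def by (blast intro: free_alg_carrier)
  moreover have "rels_det n q \<subseteq> carrier A"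
    using s odds unfolding rels_det_def by (blast intro: free_alg_carrier)
  moreover have "rels_refl n q \<subseteq> carrier A"
    using s unfolding rels_refl_def rel_refl_def by (blast intro: free_alg_carrier)
  ultimately show ?thesis by blast
qed

sublocale A: ring A by (rule free_alg_ring)

sublocale I: ideal "sp_ideal n q" A
  unfolding sp_ideal_def by (rule A.genideal_ideal) (rule rels_carrier)

sublocale U: ring U
  unfolding Uq_sp_def by (rule I.quotient_is_ring)

definition cls :: "sp_gen free_alg \<Rightarrow> sp_elem" where
  "cls f = sp_class n q (restrict_letters (sp_gens n) f)"

lemma cls_eq: "f \<in> carrier A \<Longrightarrow> cls f = sp_class n q f"
  by (simp add: cls_def restrict_letters_ident)

lemma sp_class_hom: "sp_class n q \<in> ring_hom A U"
proof -
  have "sp_class n q = (\<lambda>x. sp_ideal n q +>\<^bsub>A\<^esub> x)" by (simp add: sp_class_def fun_eq_iff)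
  then show ?thesis using I.rcos_ring_hom by (simp add: Uq_sp_def)
qed

lemma cls_closed: "cls f \<in> carrier U"
  unfolding cls_def using ring_hom_closed[OF sp_class_hom] restrict_letters_in_carrier by blast

lemma cls_add: "cls (f + g) = cls f \<oplus>\<^bsub>U\<^esub> cls g"
  using ring_hom_add[OF sp_class_hom restrict_letters_in_carrier restrict_letters_in_carrier, of f g]
  by (simp add: cls_def restrict_letters_add) (simp add: free_alg_ops)

lemma cls_mult: "cls (f * g) = cls f \<otimes>\<^bsub>U\<^esub> cls g"
  using ring_hom_mult[OF sp_class_hom restrict_letters_in_carrier restrict_letters_in_carrier, of f g]
  by (simp add: cls_def restrict_letters_mult) (simp add: free_alg_ops)

lemma cls_1: "cls 1 = \<one>\<^bsub>U\<^esub>"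
  using ring_hom_one[OF sp_class_hom]
  by (simp add: cls_def restrict_letters_1) (simp add: free_alg_ops)

lemma cls_ideal: "f \<in> sp_ideal n q \<Longrightarrow> cls f = \<zero>\<^bsub>U\<^esub>"
  using I.a_rcos_const[of f] I.a_subset
  by (subst cls_eq) (auto simp: sp_class_def Uq_sp_def FactRing_def)

lemma cls_0: "cls 0 = \<zero>\<^bsub>U\<^esub>"
  using cls_ideal I.zero_closed by (simp add: free_alg_ops)

lemma cls_surj: "u \<in> carrier U \<Longrightarrow> \<exists>f. u = cls f"
  unfolding Uq_sp_def FactRing_def A_RCOSETS_def'
  using cls_eq by (auto simp: sp_class_def)

definition cls_kernel :: "sp_gen free_alg set" where
  "cls_kernel = {f. cls f = \<zero>\<^bsub>U\<^esub>}"

lemma sp_relations_cls_kernel: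
  assumes "q \<noteq> 0" "\<And>k::nat. k > 0 \<Longrightarrow> q ^ k \<noteq> 1"
  shows "sp_relations n q cls_kernel"
proof
  show "left_ideal cls_kernel"
    by (auto simp: left_ideal_def cls_kernel_def cls_0 cls_add cls_mult cls_closed)
  show "x * a \<in> cls_kernel" if "x \<in> cls_kernel" for x a
    using that by (simp add: cls_kernel_def cls_mult cls_closed)
  show "rels_zero n \<union> rels_inv n \<union> rels_det n q \<union> rels_refl n q \<subseteq> cls_kernel"
    using A.genideal_self[OF rels_carrier] cls_ideal unfolding cls_kernel_def sp_ideal_def by blast
  show "fgen g \<in> cls_kernel" if "g \<notin> sp_gens n" for g
    using that cls_0 by (simp add: cls_kernel_def cls_def restrict_letters_fgen restrict_letters_0)
qed (use assms in auto)

definition annihilator :: "(sp_elem, 'v) module \<Rightarrow> 'v \<Rightarrow> sp_gen free_alg set" where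
  "annihilator V v = {f. cls f \<odot>\<^bsub>V\<^esub> v = \<zero>\<^bsub>V\<^esub>}"

end

section \<open>Representations and the annihilators of their vectors\<close>

locale sp_module = sp_algebra n q + V: left_module "Uq_sp n q" V
  for n q and V :: "(sp_elem, 'v) module"
begin

lemma act_closed: "v \<in> carrier V \<Longrightarrow> cls f \<odot>\<^bsub>V\<^esub> v \<in> carrier V"
  by (simp add: cls_closed)

lemma act_add: "v \<in> carrier V \<Longrightarrow> cls (f + g) \<odot>\<^bsub>V\<^esub> v = cls f \<odot>\<^bsub>V\<^esub> v \<oplus>\<^bsub>V\<^esub> cls g \<odot>\<^bsub>V\<^esub> v"
  by (simp add: cls_add cls_closed V.smult_l_distr)

lemma act_mult: "v \<in> carrier V \<Longrightarrow> cls (f * g) \<odot>\<^bsub>V\<^esub> v = cls f \<odot>\<^bsub>V\<^esub> (cls g \<odot>\<^bsub>V\<^esub> v)"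
  by (simp add: cls_mult cls_closed V.smult_assoc)

lemma act_1: "v \<in> carrier V \<Longrightarrow> cls 1 \<odot>\<^bsub>V\<^esub> v = v"
  by (simp add: cls_1)

lemma act_0: "v \<in> carrier V \<Longrightarrow> cls 0 \<odot>\<^bsub>V\<^esub> v = \<zero>\<^bsub>V\<^esub>"
  by (simp add: cls_0)

lemma annihilator_left_ideal:
  assumes "v \<in> carrier V"
  shows "left_ideal (annihilator V v)" "cls_kernel \<subseteq> annihilator V v"
  using assms
  by (simp_all add: left_ideal_def annihilator_def cls_kernel_def act_0 act_add act_mult cls_closed
      subset_iff)

lemma annihilator_diff:
  assumes v: "v \<in> carrier V"
  shows "f - g \<in> annihilator V v \<longleftrightarrow> cls f \<odot>\<^bsub>V\<^esub> v = cls g \<odot>\<^bsub>V\<^esub> v"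
proof -
  have "cls f \<odot>\<^bsub>V\<^esub> v = cls (f - g) \<odot>\<^bsub>V\<^esub> v \<oplus>\<^bsub>V\<^esub> cls g \<odot>\<^bsub>V\<^esub> v"
    using act_add[OF v, of "f - g" g] by simp
  then show ?thesis
    unfolding annihilator_def mem_Collect_eq
    using V.M.add.r_cancel_one[OF act_closed[OF v, of g] act_closed[OF v, of "f - g"]] by simp
qed

lemma annihilator_act:
  "v \<in> carrier V \<Longrightarrow> f \<in> annihilator V (cls g \<odot>\<^bsub>V\<^esub> v) \<longleftrightarrow> f * g \<in> annihilator V v"
  by (simp add: annihilator_def act_mult)

lemma one_annihilator: "v \<in> carrier V \<Longrightarrow> 1 \<in> annihilator V v \<longleftrightarrow> v = \<zero>\<^bsub>V\<^esub>"
  by (simp add: annihilator_def act_1)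

text \<open>The form in which a submodule enters \<open>top_vector_mem\<close>.\<close>

lemma mem_submodule_left_ideal:
  assumes "submodule N U V" "v \<in> carrier V"
  shows "left_ideal {f. cls f \<odot>\<^bsub>V\<^esub> v \<in> N}" "annihilator V v \<subseteq> {f. cls f \<odot>\<^bsub>V\<^esub> v \<in> N}"
  using assms V.submoduleD[OF assms(1)] cls_closed
  by (auto simp: left_ideal_def annihilator_def act_0 act_add act_mult)

lemma irreducible_generated:
  assumes "irreducible_module U V" "v \<in> carrier V" "v \<noteq> \<zero>\<^bsub>V\<^esub>" "w \<in> carrier V"
  shows "\<exists>f. w = cls f \<odot>\<^bsub>V\<^esub> v"
proof -
  let ?N = "{cls f \<odot>\<^bsub>V\<^esub> v | f. True}"
  have "submodule ?N U V"
  proof (rule V.submoduleI')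
    show "\<zero>\<^bsub>V\<^esub> \<in> ?N" using act_0[OF assms(2)] by (auto intro: exI[of _ 0])
    show "x \<oplus>\<^bsub>V\<^esub> y \<in> ?N" if "x \<in> ?N" "y \<in> ?N" for x y
      using that act_add[OF assms(2)] by (auto simp flip: act_add[OF assms(2)])
    show "a \<odot>\<^bsub>V\<^esub> x \<in> ?N" if "a \<in> carrier U" "x \<in> ?N" for a x
    proof -
      obtain g where "a = cls g" using cls_surj \<open>a \<in> carrier U\<close> by blast
      moreover obtain f where "x = cls f \<odot>\<^bsub>V\<^esub> v" using \<open>x \<in> ?N\<close> by blast
      ultimately have "a \<odot>\<^bsub>V\<^esub> x = cls (g * f) \<odot>\<^bsub>V\<^esub> v"
        by (simp add: act_mult[OF assms(2)])
      then show ?thesis by blast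
    qed
  qed (use act_closed[OF assms(2)] in auto)
  moreover have "v \<in> ?N" using act_1[OF assms(2)] by (auto intro: exI[of _ 1])
  ultimately show ?thesis using assms unfolding irreducible_module_def by blast
qed

text \<open>By irreducibility each spanning vector is some element of the algebra applied to
  \<open>v\<close>; lifts of these elements span the free algebra modulo the annihilator.\<close>

lemma finite_dimensional_cofinite_span:
  assumes "irreducible_module U V" "v \<in> carrier V" "v \<noteq> \<zero>\<^bsub>V\<^esub>" "finite_dimensional n q V"
  shows "\<exists>B. cofinite_span B (annihilator V v)"
proof -
  obtain B where B: "finite B" "B \<subseteq> carrier V"
    "\<And>w. w \<in> carrier V \<Longrightarrow> \<exists>c. w = (\<Oplus>\<^bsub>V\<^esub>b\<in>B. sp_class n q (fconst (c b)) \<odot>\<^bsub>V\<^esub> b)"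
    using assms(4) unfolding finite_dimensional_def by blast
  have "\<forall>b\<in>B. \<exists>f. b = cls f \<odot>\<^bsub>V\<^esub> v"
    using irreducible_generated[OF assms(1-3)] B(2) by blast
  then obtain g where g: "\<forall>b\<in>B. b = cls (g b) \<odot>\<^bsub>V\<^esub> v" by (rule bchoice[THEN exE])
  \<comment> \<open>Acting on \<open>v\<close> recovers b from \<open>g b\<close>, so sums over
    \<open>B\<close> can be indexed by the lifts.\<close>
  then have inj: "inj_on g B" by (intro inj_onI) metis
  have sum: "(\<Oplus>\<^bsub>V\<^esub>b\<in>B'. sp_class n q (fconst (c b)) \<odot>\<^bsub>V\<^esub> b) = cls (\<Sum>b\<in>B'. c b *\<^sub>F g b) \<odot>\<^bsub>V\<^esub> v"
    if "finite B'" "B' \<subseteq> B" for B' c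
    using that
  proof (induction B' rule: finite_induct)
    case empty
    then show ?case using act_0[OF assms(2)] by simp
  next
    case (insert b B')
    have fconst: "sp_class n q (fconst c) = cls (fconst c)" for c
      by (simp add: cls_eq free_alg_carrier)
    have "sp_class n q (fconst (c b)) \<odot>\<^bsub>V\<^esub> b = cls (c b *\<^sub>F g b) \<odot>\<^bsub>V\<^esub> v"
      using g insert.prems by (simp add: fscale_def act_mult[OF assms(2)] fconst)
    with insert B(2) show ?case
      by (subst V.M.finsum_insert) (auto simp: act_add[OF assms(2)] act_closed[OF assms(2)] fconst cls_closed)
  qed
  have "\<exists>c. f - (\<Sum>b\<in>g ` B. c b *\<^sub>F b) \<in> annihilator V v" for f
  proof -
    obtain c where "cls f \<odot>\<^bsub>V\<^esub> v = cls (\<Sum>b\<in>B. c b *\<^sub>F g b) \<odot>\<^bsub>V\<^esub> v"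
      using B(3)[OF act_closed[OF assms(2)], of f] sum[OF B(1) subset_refl] by metis
    moreover have "(\<Sum>b\<in>B. c b *\<^sub>F g b) = (\<Sum>b\<in>g ` B. c (inv_into B g b) *\<^sub>F b)"
      using inj by (simp add: sum.reindex)
    ultimately show ?thesis using annihilator_diff[OF assms(2)] by auto
  qed
  then show ?thesis using B(1) unfolding cofinite_span_def by blast
qed

end

text \<open>A maximal submodule avoiding \<open>x\<close> lies in the largest one, \<open>K\<close>,
  and therefore equals it; this is the uniqueness behind the definite description.\<close>

lemma maximal_submodule_avoiding_eqI:
  assumes "submodule K R M" "x \<notin> K" "\<And>N. submodule N R M \<Longrightarrow> x \<notin> N \<Longrightarrow> N \<subseteq> K"
  shows "maximal_submodule_avoiding R M x = K"
  unfolding maximal_submodule_avoiding_def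
proof (rule the_equality)
  show "submodule K R M \<and> x \<notin> K \<and> (\<forall>N'. submodule N' R M \<longrightarrow> x \<notin> N' \<longrightarrow> K \<subseteq> N' \<longrightarrow> N' = K)"
    using assms by blast
next
  fix N assume "submodule N R M \<and> x \<notin> N \<and> (\<forall>N'. submodule N' R M \<longrightarrow> x \<notin> N' \<longrightarrow> N \<subseteq> N' \<longrightarrow> N' = N)"
  then show "N = K" using assms by blast
qed

section \<open>Identification of V with L(lambda)\<close>

context sp_module
begin

text \<open>The action on \<open>v\<close> maps U onto V and factors through M(lambda), so V is the
  quotient by the kernel. The point is that this kernel contains every submodule avoiding
  \<xi>.\<close>

lemma irreducible_highest_weight_isomorphic:
  assumes q: "q \<noteq> 0" "\<And>k::nat. k > 0 \<Longrightarrow> q ^ k \<noteq> 1"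
    and irr: "irreducible_module U V"
    and v: "v \<in> carrier V" "v \<noteq> \<zero>\<^bsub>V\<^esub>"
    and lam_nz: "\<And>i. i \<in> odds n \<Longrightarrow> lam i \<noteq> 0"
    and torus: "\<And>i. i \<in> odds n \<Longrightarrow> fs i (i + 1) - fconst (lam i) \<in> annihilator V v"
    and raising: "\<And>i j. i \<in> odds n \<Longrightarrow> j \<in> {1..i} \<Longrightarrow> fs i j \<in> annihilator V v"
  shows "isomorphic_modules U V (irr_quotient n q lam)"
proof -
  let ?P = "regular_module U"
  let ?I = "verma_ideal n q lam"
  let ?G = "{fs i j | i j. i \<in> odds n \<and> j \<in> {1..i}} \<union> {fs i (i+1) - fconst (lam i) | i. i \<in> odds n}"
  let ?S = "{sp_class n q (fs i j) | i j. i \<in> odds n \<and> j \<in> {1..i}} \<union>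
      {sp_class n q (fs i (i+1) - fconst (lam i)) | i. i \<in> odds n}"
  have "fs i j \<in> carrier A" if "i \<in> odds n" "j \<in> {1..i+1}" for i j
    using that by (intro free_alg_carrier) (auto simp: sp_gens_def odds_def elim!: oddE)
  then have "?G \<subseteq> carrier A" by (force intro: free_alg_carrier)
  \<comment> \<open>On the carrier \<open>cls\<close> and \<open>sp_class\<close> agree, which
    brings the generators of the Verma ideal into the language of annihilators.\<close>
  then have "cls ` ?G = sp_class n q ` ?G" by (intro image_cong refl cls_eq) (rule subsetD)
  also have "\<dots> = ?S" unfolding image_Un by (intro arg_cong2[of _ _ _ _ "(\<union>)"]) blast+
  finally have S: "?S = cls ` ?G" by (rule sym)
  have S_carrier: "?S \<subseteq> carrier U" unfolding S using cls_closed by blast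
  interpret P: left_module U ?P using regular_left_module[OF U.ring_axioms] .
  have P_simps: "carrier ?P = carrier U" "x \<oplus>\<^bsub>?P\<^esub> y = x \<oplus>\<^bsub>U\<^esub> y" "x \<odot>\<^bsub>?P\<^esub> y = x \<otimes>\<^bsub>U\<^esub> y" for x y
    by (simp_all add: regular_module_def)
  interpret \<phi>: left_module_epi U ?P V "\<lambda>u. u \<odot>\<^bsub>V\<^esub> v"
  proof unfold_locales
    show "left_module_hom U ?P V (\<lambda>u. u \<odot>\<^bsub>V\<^esub> v)"
      using v(1) by (auto simp: left_module_hom_def P_simps V.smult_l_distr V.smult_assoc)
    show "(\<lambda>u. u \<odot>\<^bsub>V\<^esub> v) ` carrier ?P = carrier V"
      unfolding P_simps using irreducible_generated[OF irr v] v(1) cls_closed by fastforce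
  qed
  have I: "submodule ?I U ?P" "?S \<subseteq> ?I"
    unfolding verma_ideal_def by (rule left_ideal_gen_submodule[OF U.ring_axioms S_carrier])+
  have "?S \<subseteq> \<phi>.kernel_submodule"
    unfolding S \<phi>.kernel_submodule_def P_simps
    using torus raising cls_closed by (auto simp: annihilator_def)
  then have "?I \<subseteq> \<phi>.kernel_submodule"
    unfolding verma_ideal_def left_ideal_gen_def using \<phi>.kernel_submodule by blast
  then obtain \<psi> where \<psi>: "left_module_epi U (quotient_module ?P ?I) V \<psi>"
    "\<And>u. u \<in> carrier U \<Longrightarrow> \<psi> (?I +>\<^bsub>?P\<^esub> u) = u \<odot>\<^bsub>V\<^esub> v"
    using \<phi>.factor[OF I(1)] P_simps(1) by metis
  let ?M = "verma n q lam"
  let ?\<xi> = "verma_vec n q lam"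
  interpret \<psi>: left_module_epi U ?M V \<psi> using \<psi>(1) by (simp add: verma_def)
  interpret Q: left_module_quotient U ?P ?I
    by (intro left_module_quotient.intro left_module_quotient_axioms.intro I P.left_module_axioms)
  interpret M: sp_module n q ?M by unfold_locales
  have \<xi>: "?\<xi> \<in> carrier ?M" "\<psi> ?\<xi> = v"
    using v(1) \<psi>(2)[OF U.one_closed] by (auto simp: verma_vec_def verma_def Q.quotient_simps P_simps)
  have cls_\<xi>: "cls f \<odot>\<^bsub>?M\<^esub> ?\<xi> = ?I +>\<^bsub>?P\<^esub> cls f" for f
    using Q.quotient_simps(4)[of "cls f" "\<one>\<^bsub>U\<^esub>"] cls_closed
    by (simp add: verma_vec_def verma_def P_simps)
  have \<xi>_gen: "\<exists>f. x = cls f \<odot>\<^bsub>?M\<^esub> ?\<xi>" if "x \<in> carrier ?M" for x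
    using that cls_surj unfolding cls_\<xi> by (auto simp: verma_def Q.quotient_simps P_simps)
  have ann_\<xi>: "f \<in> annihilator ?M ?\<xi> \<longleftrightarrow> cls f \<in> ?I" for f
    using Q.coset_eq_zero_iff[of "cls f"] cls_closed
    by (simp add: annihilator_def cls_\<xi>) (simp add: verma_def Q.quotient_simps P_simps)
  have G: "?G \<subseteq> annihilator ?M ?\<xi>" using I(2) unfolding S by (blast intro: iffD2[OF ann_\<xi>])
  interpret rel: sp_relations n q cls_kernel using sp_relations_cls_kernel[OF q] .
  interpret hw: highest_weight_ideal n q cls_kernel "annihilator ?M ?\<xi>" lam
    by unfold_locales (use M.annihilator_left_ideal[OF \<xi>(1)] lam_nz G in blast)+
  have ann_mono: "annihilator ?M ?\<xi> \<subseteq> annihilator V v"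
  proof
    fix f assume "f \<in> annihilator ?M ?\<xi>"
    then show "f \<in> annihilator V v"
      using left_module_homD(3)[OF \<psi>.hom cls_closed \<xi>(1), of f] \<psi>.hom_zero \<xi>(2)
      by (simp add: annihilator_def)
  qed
  \<comment> \<open>A vector x of N outside the kernel has nonzero image, which some f carries to v
    by irreducibility. With x = g \<xi>, the element w = f g meets the hypotheses of
    \<open>top_vector_mem\<close>, so \<xi> would lie in N.\<close>
  have sub: "N \<subseteq> \<psi>.kernel_submodule" if N: "submodule N U ?M" "?\<xi> \<notin> N" for N
  proof (rule subsetI, rule ccontr)
    fix x assume x: "x \<in> N" "x \<notin> \<psi>.kernel_submodule"
    have xM: "x \<in> carrier ?M" using \<psi>.M.submoduleD(1)[OF N(1)] x(1) by blast
    with x(2) have "\<psi> x \<noteq> \<zero>\<^bsub>V\<^esub>" unfolding \<psi>.kernel_submodule_def by blast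
    then obtain f where f: "v = cls f \<odot>\<^bsub>V\<^esub> \<psi> x"
      using irreducible_generated[OF irr left_module_homD(1)[OF \<psi>.hom xM] _ v(1)] by blast
    obtain g where g: "x = cls g \<odot>\<^bsub>?M\<^esub> ?\<xi>" using \<xi>_gen[OF xM] by blast
    have "cls (f * g) \<odot>\<^bsub>?M\<^esub> ?\<xi> \<in> N"
      using M.act_mult[OF \<xi>(1)] g \<psi>.M.submoduleD(4)[OF N(1) cls_closed x(1)] by simp
    then have fg: "f * g \<in> {f. cls f \<odot>\<^bsub>?M\<^esub> ?\<xi> \<in> N}" by (rule CollectI)
    have "\<psi> x = cls g \<odot>\<^bsub>V\<^esub> v"
      using left_module_homD(3)[OF \<psi>.hom cls_closed \<xi>(1), of g] by (simp only: g \<xi>(2))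
    then have "cls (f * g) \<odot>\<^bsub>V\<^esub> v = cls 1 \<odot>\<^bsub>V\<^esub> v"
      unfolding act_mult[OF v(1)] act_1[OF v(1)] using f by metis
    then have "f * g - 1 \<in> annihilator V v" by (rule iffD2[OF annihilator_diff[OF v(1)]])
    moreover have "1 \<notin> annihilator V v" using one_annihilator[OF v(1)] v(2) by blast
    ultimately have "1 \<in> {f. cls f \<odot>\<^bsub>?M\<^esub> ?\<xi> \<in> N}"
      using hw.top_vector_mem[OF M.mem_submodule_left_ideal[OF N(1) \<xi>(1)]
          annihilator_left_ideal(1)[OF v(1)] ann_mono] fg by blast
    then show False using N(2) M.act_1[OF \<xi>(1)] by simp
  qed
  have "?\<xi> \<notin> \<psi>.kernel_submodule" using \<xi> v(2) unfolding \<psi>.kernel_submodule_def by blast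
  then have "maximal_submodule_avoiding U ?M ?\<xi> = \<psi>.kernel_submodule"
    using maximal_submodule_avoiding_eqI[OF \<psi>.kernel_submodule] sub by blast
  then show ?thesis using \<psi>.isomorphic_quotient by (simp add: irr_quotient_def)
qed

end

theorem proposition4p1:
  fixes n :: nat and q :: complex and V :: "(sp_elem, 'v) module"
  assumes "n \<ge> 1"
    and "q \<noteq> 0"
    and "\<And>k::nat. k > 0 \<Longrightarrow> q ^ k \<noteq> 1"
    and "left_module (Uq_sp n q) V"
    and "finite_dimensional n q V"
    and "irreducible_module (Uq_sp n q) V"
  shows "\<exists>lam :: nat \<Rightarrow> complex. (\<forall>i\<in>odds n. lam i \<noteq> 0) \<and>
           isomorphic_modules (Uq_sp n q) V (irr_quotient n q lam)"
proof -
  interpret sp_module n q V using assms(4) by (rule sp_module.intro)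
  interpret rel: sp_relations n q cls_kernel using sp_relations_cls_kernel[OF assms(2,3)] .
  obtain v0 where v0: "v0 \<in> carrier V" "v0 \<noteq> \<zero>\<^bsub>V\<^esub>"
    using assms(6) V.M.zero_closed unfolding irreducible_module_def by blast
  obtain B where B: "cofinite_span B (annihilator V v0)"
    using finite_dimensional_cofinite_span[OF assms(6) v0 assms(5)] by blast
  have "1 \<notin> annihilator V v0" using one_annihilator v0 by simp
  from rel.highest_weight_vector[OF annihilator_left_ideal[OF v0(1)] B this]
  obtain f lam where f: "f \<notin> annihilator V v0"
    and lam: "\<forall>i\<in>odds n. lam i \<noteq> 0 \<and> (fs i (i + 1) - fconst (lam i)) * f \<in> annihilator V v0
      \<and> (\<forall>j\<in>{1..i}. fs i j * f \<in> annihilator V v0)" by blast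
  \<comment> \<open>The highest weight vector is f applied to \<open>v0\<close>; by
    \<open>annihilator_act\<close> an element kills it exactly when its product with f kills
    \<open>v0\<close>.\<close>
  have "isomorphic_modules (Uq_sp n q) V (irr_quotient n q lam)"
    by (rule irreducible_highest_weight_isomorphic[where v = "cls f \<odot>\<^bsub>V\<^esub> v0"])
      (use assms lam f v0 in \<open>auto simp: annihilator_act act_closed\<close>, simp add: annihilator_def)
  then show ?thesis using lam by blast
qed

end
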